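(* Let $\Sigma$ be a germ at $0$ of a closed subset of $\mathbf{R}^{n}$ with $0\in\Sigma$, let $r$ be a positive integer and $\delta>0$. Let $f:(\mathbf{R}^{n}\times\mathbf{R}^{l},0)\to(\mathbf{R}^{p},0)$ be a $C^{r+2}$ map-germ which satisfies the relative Kuo condition $(K_{\Sigma}^{r,\delta})$, and let $g:(\mathbf{R}^{n}\times\mathbf{R}^{l},0)\to(\mathbf{R}^{p},0)$ be a $C^{r+2}$ map-germ such that there exists a neighbourhood $U$ of $0$ in $\mathbf{R}^{n}\times\mathbf{R}^{l}$ with the property that, for every point $a\in(\Sigma\times\mathbf{R}^{l})\cap U$, the Taylor jets of degree $r+2$ at $a$ agree: $j^{r+2}f(a)=j^{r+2}g(a)$. Then $f$ and $g$ are $\Sigma$-$C^{0}$-BD equivalent and $\Sigma$-$C^{0}$-contact equivalent.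
   Context: Write $u=(x,\lambda)\in\mathbf{R}^{n}\times\mathbf{R}^{l}$. $\|\cdot\|$ is the Euclidean norm and $d(x,\Sigma)=\inf_{y\in\Sigma}\|x-y\|$. **Kuo pseudo-distance.** For $f=(f_1,\dots,f_p)$ let $\nabla_x f_j$ be the Euclidean gradient in the variable $x\in\mathbf{R}^n$, and $N(f,j,u)=\nabla_{x}f_j(u)-q_j(u)$, where $q_j(u)$ is the orthogonal projection of $\nabla_{x}f_j(u)$ onto the span of $\{\nabla_{x}f_i(u)\}_{i\ne j}$. Put $d_{x}\nabla f(u)=\min_{1\le j\le p}\|N(f,j,u)\|$. **Relative Kuo condition $(K_\Sigma^{r,\delta})$.** A $C^2$ map $f:(\mathbf{R}^{n}\times\mathbf{R}^{l},0)\to(\mathbf{R}^{p},0)$ satisfies it if there are constants $C,\alpha,\overline{w}>0$ such that $d_{x}\nabla f(u)\ge C\,d(x,\Sigma)^{r-\delta}$ for all $u=(x,\lambda)\in H_r^\Sigma(f,\overline{w})\cap\{\|u\|<\alpha\}$, where $H_r^\Sigma(f,\overline{w})=\{u=(x,\lambda):\|f(u)\|\le\overline{w}\,d(x,\Sigma)^r\}$. **Equivalences.** Let $G,F:(\mathbf{R}^{n}\times\mathbf{R}^{l},0)\to(\mathbf{R}^{p},0)$ be continuous. - $G$ and $F$ are $\Sigma$-$C^0$-BD equivalent (BD = bifurcation diagram) if there are a neighbourhood $V$ of $0$ in $\mathbf{R}^{n}\times\mathbf{R}^{l}$ and a map $\phi:(V,0)\to(\mathbf{R}^{n}\times\mathbf{R}^{l},0)$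 of the form $\phi(x,\lambda)=(\phi_1(x,\lambda),\lambda)$ which is a homeomorphism onto its image, satisfies $\phi(x,\lambda)=(x,\lambda)$ for all $(x,\lambda)\in V$ with $x\in\Sigma$, and satisfies $\phi(G^{-1}(0)\cap V)=F^{-1}(0)\cap\phi(V)$. - $G$ and $F$ are $\Sigma$-$C^0$-contact equivalent if there are a neighbourhood $V$ of $0$ in $\mathbf{R}^{n}\times\mathbf{R}^{l}$, a map $\phi:(V,0)\to(\mathbf{R}^{n}\times\mathbf{R}^{l},0)$ of the form $\phi(x,\lambda)=(\phi_1(x,\lambda),\lambda)$ which is a homeomorphism onto its image, satisfies $\phi(x,\lambda)=(x,\lambda)$ for all $(x,\lambda)\in V$ with $x\in\Sigma$, and satisfies $\phi(G^{-1}(0)\cap V)=F^{-1}(0)\cap\phi(V)$ (so that $\phi$ gives a $\Sigma$-$C^0$-BD equivalence), and a continuous map $T:V\to GL(\mathbf{R}^{p})$ such that $G(u)=T(u)\cdot F(\phi(u))$ for $u\in V$. *)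

theory Defs
  imports "HOL-Analysis.Analysis"
begin

text \<open>
  A map-germ \<open>(\<real>\<^sup>n \<times> \<real>\<^sup>l, 0) \<rightarrow> (\<real>\<^sup>p, 0)\<close> is given by a total function
  \<open>(real^'n) \<times> (real^'l) \<Rightarrow> real^'p\<close>, of which only the values near \<open>0\<close> matter: smoothness is
  required on some open neighbourhood of \<open>0\<close>, and all notions below restrict to
  arbitrarily small neighbourhoods. A germ at \<open>0\<close> of a closed set is given by a closed
  representative in the whole space.
\<close>

subsection \<open>Maps of class \<open>C\<^sup>k\<close> and Taylor jets\<close>

text \<open>
  For open \<open>W\<close>: a map is \<open>C\<^sup>k\<^sup>+\<^sup>1\<close> iff it is differentiable and
  \<open>x \<mapsto> D f(x) v\<close> is \<open>C\<^sup>k\<close> for every \<open>v\<close>; in finite dimension this is the usual notion.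
\<close>

fun Ck_on :: "nat \<Rightarrow> ('a::euclidean_space \<Rightarrow> 'b::real_normed_vector) \<Rightarrow> 'a set \<Rightarrow> bool" where
  "Ck_on 0 f W \<longleftrightarrow> continuous_on W f"
| "Ck_on (Suc k) f W \<longleftrightarrow>
     (\<forall>x\<in>W. f differentiable (at x)) \<and>
     (\<forall>v. Ck_on k (\<lambda>x. frechet_derivative f (at x) v) W)"

definition Ck_map_germ :: "nat \<Rightarrow> ('a::euclidean_space \<Rightarrow> 'b::real_normed_vector) \<Rightarrow> bool" where
  "Ck_map_germ k f \<longleftrightarrow> f 0 = 0 \<and> (\<exists>W. open W \<and> 0 \<in> W \<and> Ck_on k f W)"

text \<open>\<open>diag_derivative i f a h\<close> is \<open>D\<^sup>i f(a)(h, \<dots>, h)\<close>.\<close>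

fun diag_derivative ::
    "nat \<Rightarrow> ('a::euclidean_space \<Rightarrow> 'b::real_normed_vector) \<Rightarrow> 'a \<Rightarrow> 'a \<Rightarrow> 'b" where
  "diag_derivative 0 f a h = f a"
| "diag_derivative (Suc i) f a h = diag_derivative i (\<lambda>x. frechet_derivative f (at x) h) a h"

text \<open>The jet of degree \<open>k\<close> at \<open>a\<close>, as the Taylor polynomial in the increment \<open>h\<close>.\<close>

definition taylor_jet ::
    "nat \<Rightarrow> ('a::euclidean_space \<Rightarrow> 'b::real_normed_vector) \<Rightarrow> 'a \<Rightarrow> 'a \<Rightarrow> 'b" where
  "taylor_jet k f a = (\<lambda>h. \<Sum>i\<le>k. (1 / fact i) *\<^sub>R diag_derivative i f a h)"

subsection \<open>Kuo pseudo-distance and the relative Kuo condition\<close>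

definition orth_proj :: "'a::euclidean_space set \<Rightarrow> 'a \<Rightarrow> 'a" where
  "orth_proj S v = (THE q. q \<in> S \<and> (\<forall>w\<in>S. orthogonal (v - q) w))"

lemma orth_proj_ex1:
  fixes S :: "'a::euclidean_space set"
  assumes "subspace S"
  shows "\<exists>!q. q \<in> S \<and> (\<forall>w\<in>S. orthogonal (v - q) w)"
proof -
  obtain y z where yz: "y \<in> span S" "\<And>w. w \<in> span S \<Longrightarrow> orthogonal z w" "v = y + z"
    using orthogonal_subspace_decomp_exists [of S v] by blast
  have S: "span S = S"
    using assms by simp
  show ?thesis
  proof (rule ex1I [of _ y])
    show "y \<in> S \<and> (\<forall>w\<in>S. orthogonal (v - y) w)"
      using yz S by simp
  next
    fix q assume q: "q \<in> S \<and> (\<forall>w\<in>S. orthogonal (v - q) w)"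
    have "q - y \<in> S"
      using q yz(1) S assms by (simp add: subspace_diff)
    then have "orthogonal (v - q) (q - y)" "orthogonal (v - y) (q - y)"
      using q yz S by auto
    then have "(q - y) \<bullet> (q - y) = 0"
      by (simp add: orthogonal_def inner_diff_left)
    then show "q = y"
      by simp
  qed
qed

definition grad_x ::
    "((real^'n) \<times> (real^'l) \<Rightarrow> real^'p) \<Rightarrow> 'p \<Rightarrow> (real^'n) \<times> (real^'l) \<Rightarrow> real^'n" where
  "grad_x f j u = (THE D. GDERIV (\<lambda>x. f (x, snd u) $ j) (fst u) :> D)"

lemma grad_x_eq:
  assumes "GDERIV (\<lambda>x. f (x, snd u) $ j) (fst u) :> D"
  shows "grad_x f j u = D"
  unfolding grad_x_def
proof (rule the_equality)
  show "GDERIV (\<lambda>x. f (x, snd u) $ j) (fst u) :> D"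
    by (rule assms)
next
  fix D' assume "GDERIV (\<lambda>x. f (x, snd u) $ j) (fst u) :> D'"
  then have "(\<lambda>h. h \<bullet> D') = (\<lambda>h. h \<bullet> D)"
    using assms unfolding gderiv_def by (rule has_derivative_unique)
  then show "D' = D"
    by (metis vector_eq_ldot)
qed

definition kuo_N ::
    "((real^'n) \<times> (real^'l) \<Rightarrow> real^'p) \<Rightarrow> 'p \<Rightarrow> (real^'n) \<times> (real^'l) \<Rightarrow> real^'n" where
  "kuo_N f j u = grad_x f j u - orth_proj (span ((\<lambda>i. grad_x f i u) ` (- {j}))) (grad_x f j u)"

definition kuo_dist :: "((real^'n) \<times> (real^'l) \<Rightarrow> real^'p) \<Rightarrow> (real^'n) \<times> (real^'l) \<Rightarrow> real" where
  "kuo_dist f u = (MIN j. norm (kuo_N f j u))"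

definition horn_nbhd ::
    "(real^'n) set \<Rightarrow> nat \<Rightarrow> ((real^'n) \<times> (real^'l) \<Rightarrow> real^'p) \<Rightarrow> real \<Rightarrow> ((real^'n) \<times> (real^'l)) set" where
  "horn_nbhd \<Sigma> r f w = {u. norm (f u) \<le> w * infdist (fst u) \<Sigma> ^ r}"

text \<open>
  The exponent \<open>r - \<delta>\<close> is real. At points with \<open>x \<in> \<Sigma>\<close> the convention \<open>0 powr s = 0\<close>
  makes the inequality trivial. For \<open>\<delta> < r\<close> this is the usual value of the power; for
  \<open>\<delta> \<ge> r\<close>, where the power of \<open>0\<close> is conventional, it is the least restrictive reading.
\<close>

definition rel_kuo_condition ::
    "(real^'n) set \<Rightarrow> nat \<Rightarrow> real \<Rightarrow> ((real^'n) \<times> (real^'l) \<Rightarrow> real^'p) \<Rightarrow> bool" where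
  "rel_kuo_condition \<Sigma> r \<delta> f \<longleftrightarrow>
     (\<exists>C>0. \<exists>\<alpha>>0. \<exists>w>0. \<forall>u. u \<in> horn_nbhd \<Sigma> r f w \<and> norm u < \<alpha> \<longrightarrow>
        kuo_dist f u \<ge> C * infdist (fst u) \<Sigma> powr (real r - \<delta>))"

subsection \<open>Equivalences relative to \<open>\<Sigma>\<close>\<close>

text \<open>\<open>\<phi>\<close>, defined on the open neighbourhood \<open>V\<close> of \<open>0\<close>, realises a BD equivalence.\<close>

definition BD_equivalence_map ::
    "(real^'n) set \<Rightarrow> ((real^'n) \<times> (real^'l) \<Rightarrow> real^'p) \<Rightarrow> ((real^'n) \<times> (real^'l) \<Rightarrow> real^'p) \<Rightarrow>
     ((real^'n) \<times> (real^'l)) set \<Rightarrow> ((real^'n) \<times> (real^'l) \<Rightarrow> (real^'n) \<times> (real^'l)) \<Rightarrow> bool" where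
  "BD_equivalence_map \<Sigma> G F V \<phi> \<longleftrightarrow>
     open V \<and> 0 \<in> V \<and> \<phi> 0 = 0 \<and>
     (\<exists>\<phi>\<^sub>1. \<forall>(x, t)\<in>V. \<phi> (x, t) = (\<phi>\<^sub>1 (x, t), t)) \<and>
     (\<exists>\<psi>. homeomorphism V (\<phi> ` V) \<phi> \<psi>) \<and>
     (\<forall>(x, t)\<in>V. x \<in> \<Sigma> \<longrightarrow> \<phi> (x, t) = (x, t)) \<and>
     \<phi> ` (G -` {0} \<inter> V) = F -` {0} \<inter> \<phi> ` V"

definition C0_BD_equivalent ::
    "(real^'n) set \<Rightarrow> ((real^'n) \<times> (real^'l) \<Rightarrow> real^'p) \<Rightarrow> ((real^'n) \<times> (real^'l) \<Rightarrow> real^'p) \<Rightarrow> bool" where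
  "C0_BD_equivalent \<Sigma> G F \<longleftrightarrow> (\<exists>V \<phi>. BD_equivalence_map \<Sigma> G F V \<phi>)"

definition C0_contact_equivalent ::
    "(real^'n) set \<Rightarrow> ((real^'n) \<times> (real^'l) \<Rightarrow> real^'p) \<Rightarrow> ((real^'n) \<times> (real^'l) \<Rightarrow> real^'p) \<Rightarrow> bool" where
  "C0_contact_equivalent \<Sigma> G F \<longleftrightarrow>
     (\<exists>V \<phi> (T :: (real^'n) \<times> (real^'l) \<Rightarrow> real^'p^'p).
        BD_equivalence_map \<Sigma> G F V \<phi> \<and>
        continuous_on V T \<and> (\<forall>u\<in>V. invertible (T u)) \<and>
        (\<forall>u\<in>V. G u = T u *v F (\<phi> u)))"

end

theory Submission
  imports Defs
begin

text \<open>
  Put \<open>h = g - f\<close> and \<open>F t = f + t h\<close>, and let \<open>d\<close> be the distance of \<open>x\<close> to \<open>\<Sigma>\<close>. Equality of the jets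
  gives \<open>h = O(d\<^sup>r\<^sup>+\<^sup>2)\<close> and \<open>O(d\<^sup>r\<^sup>+\<^sup>1)\<close> for its gradients in \<open>x\<close>. By the Kuo condition the gradients
  of the components of \<open>F t\<close> are independent, with a bound of order \<open>d\<^sup>r\<close>, in a horn around the
  zero set of \<open>F t\<close>. There \<open>D\<^sub>x(F t) V = h\<close> has a solution \<open>V = O(d\<^sup>2)\<close> in the span of the gradients,
  and the field \<open>- V\<close>, cut off outside the horn, is locally Lipschitz away from \<open>\<Sigma>\<close> and dominated
  by \<open>d / 4\<close>. Hence its time-one map \<open>\<phi>\<close> is a homeomorphism fixing \<open>\<Sigma> \<times> \<real>\<^sup>l\<close>. Along the flow, \<open>F t\<close> is
  constant for solutions that start close to the zero set of \<open>f\<close> and drifts by \<open>O(d\<^sup>r\<^sup>+\<^sup>2)\<close> for the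
  others. So \<open>g \<circ> \<phi> = f\<close> on a horn around the zero set of \<open>f\<close> and \<open>g \<circ> \<phi> - f = O(d\<^sup>r\<^sup>+\<^sup>2)\<close> near \<open>0\<close>, which
  makes the matrices of the contact equivalence continuous.
\<close>

section \<open>Flows of vector fields controlled by a distance function\<close>

text \<open>Near \<open>\<Sigma>\<close> only the size of \<open>V\<close> is controlled: the Gram
  determinant in its denominator degenerates there, and no Lipschitz bound up to
  \<open>\<Sigma>\<close> is available. The flow therefore rests on two facts alone: local Lipschitz
  continuity where a 1-Lipschitz function \<open>\<rho>\<close> is positive, and the bound
  \<open>\<rho> / 4\<close> everywhere. A solution from \<open>u\<close> then moves by at most
  \<open>\<rho> u / 3\<close>, so it never reaches the bad set, and continuity at that set follows
  from the same bound. Letting \<open>\<rho>\<close> vanish outside a ball as well makes the flow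
  global, with a time-one map that is a homeomorphism of the whole space. The two extra degrees of
  the jets are spent here: \<open>O(d^(r+2))\<close> divided by \<open>d^r\<close> is
  \<open>O(d^2)\<close>, which is below \<open>d / 4\<close> on a small ball. For
  \<open>d \<le> 1\<close> the Kuo bound with exponent \<open>r - \<delta>\<close> implies the one
  with exponent \<open>r\<close>, the form used throughout; the remaining constants are absorbed by
  the radius of the ball.\<close>

lemma vector_derivative_bound_interval:
  fixes z :: "real \<Rightarrow> 'a::real_normed_vector"
  assumes "\<And>t. t \<in> {0..1} \<Longrightarrow> (z has_vector_derivative z' t) (at t within {0..1})"
    and "\<And>t. t \<in> {0..1} \<Longrightarrow> norm (z' t) \<le> B" and "s \<in> {0..1}" "t \<in> {0..1}"
  shows "norm (z t - z s) \<le> B * \<bar>t - s\<bar>"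
proof -
  have "norm (z t - z s) \<le> B * norm (t - s)"
  proof (rule differentiable_bound[where S = "{0..1}" and f' = "\<lambda>t h. h *\<^sub>R z' t"])
    show "(z has_derivative (\<lambda>h. h *\<^sub>R z' x)) (at x within {0..1})" if "x \<in> {0..1}" for x
      using assms(1)[OF that] by (simp add: has_vector_derivative_def)
    show "onorm (\<lambda>h. h *\<^sub>R z' x) \<le> B" if "x \<in> {0..1}" for x
    proof (rule onorm_le)
      show "norm (h *\<^sub>R z' x) \<le> B * norm h" for h
        using mult_right_mono[OF assms(2)[OF that], of "\<bar>h\<bar>"] by (simp add: mult.commute)
    qed
  qed (use assms in auto)
  then show ?thesis by simp
qed

text \<open>Successive Picard iterates differ by at most \<open>M L^k t^k / k!\<close>. This is
  summable uniformly on the whole of \<open>[0, 1]\<close>, so no subdivision into short time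
  intervals is required.\<close>

lemma picard_lindelof_lipschitz:
  fixes G :: "real \<Rightarrow> 'a::euclidean_space \<Rightarrow> 'a"
  assumes cont: "continuous_on ({0..1} \<times> UNIV) (\<lambda>(t, v). G t v)"
    and lip: "\<And>t. t \<in> {0..1} \<Longrightarrow> L-lipschitz_on UNIV (G t)"
    and bnd: "\<And>t v. t \<in> {0..1} \<Longrightarrow> norm (G t v) \<le> M"
  shows "\<exists>z. z 0 = u \<and> (\<forall>t\<in>{0..1}. (z has_vector_derivative G t (z t)) (at t within {0..1}))"
proof -
  have L0: "0 \<le> L" using lip[of 0] by (auto dest: lipschitz_on_nonneg)
  have M0: "0 \<le> M" using order_trans[OF norm_ge_zero bnd[of 0 undefined]] by simp
  define z where "z = rec_nat (\<lambda>t. u) (\<lambda>_ w t. u + integral {0..t} (\<lambda>s. G s (w s)))"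
  have z0: "z 0 t = u" and zS: "z (Suc k) t = u + integral {0..t} (\<lambda>s. G s (z k s))" for k t
    by (simp_all add: z_def)
  have contG: "continuous_on {0..1} (\<lambda>s. G s (w s))" if "continuous_on {0..1} w" for w
  proof -
    have "continuous_on {0..1} ((\<lambda>(t, v). G t v) \<circ> (\<lambda>s. (s, w s)))"
    proof (rule continuous_on_compose)
      show "continuous_on {0..1} (\<lambda>s. (s, w s))" by (intro continuous_intros that)
      show "continuous_on ((\<lambda>s. (s, w s)) ` {0..1}) (\<lambda>(t, v). G t v)"
        by (rule continuous_on_subset[OF cont]) auto
    qed
    then show ?thesis by (simp add: comp_def)
  qed
  have zc: "continuous_on {0..1} (z k)" for k
  proof (induction k)
    case 0
    then show ?case by (simp add: z0)
  next
    case (Suc k)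
    have "continuous_on {0..1} (\<lambda>t. u + integral {0..t} (\<lambda>s. G s (z k s)))"
      by (intro continuous_intros indefinite_integral_continuous_1 integrable_continuous_interval
          contG Suc)
    then show ?case by (simp add: zS)
  qed
  have int: "(\<lambda>s. G s (w s)) integrable_on {0..t}" if "continuous_on {0..1} w" "t \<in> {0..1}" for w t
    by (rule integrable_continuous_interval, rule continuous_on_subset[OF contG[OF that(1)]])
      (use that(2) in auto)
  have step: "norm (z (Suc k) t - z k t) \<le> M * L ^ k * t ^ k / fact k" if "t \<in> {0..1}" for k t
    using that
  proof (induction k arbitrary: t)
    case 0
    have "norm (integral {0..t} (\<lambda>s. G s (z 0 s))) \<le> integral {0..t} (\<lambda>s. M)"
      by (rule integral_norm_bound_integral) (use int[OF zc] bnd 0 in auto)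
    also have "\<dots> \<le> M" using 0 M0 by (simp add: mult_left_le_one_le)
    finally show ?case by (simp add: z0 zS)
  next
    case (Suc k)
    have i: "((\<lambda>s. L * (M * L ^ k * s ^ k / fact k)) has_integral
        M * L ^ Suc k * t ^ Suc k / fact (Suc k) - M * L ^ Suc k * 0 ^ Suc k / fact (Suc k)) {0..t}"
    proof (rule fundamental_theorem_of_calculus)
      show "0 \<le> t" using Suc by simp
      fix s :: real assume "s \<in> {0..t}"
      have "((\<lambda>t. M * L ^ Suc k * t ^ Suc k / fact (Suc k)) has_field_derivative
          M * L ^ Suc k * (real (Suc k) * s ^ k) / fact (Suc k)) (at s within {0..t})"
        by (rule derivative_eq_intros refl | simp)+
      moreover have "M * L ^ Suc k * (real (Suc k) * s ^ k) / fact (Suc k)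
          = L * (M * L ^ k * s ^ k / fact k)"
        by (simp add: divide_simps del: of_nat_Suc)
      ultimately show "((\<lambda>t. M * L ^ Suc k * t ^ Suc k / fact (Suc k)) has_vector_derivative
          L * (M * L ^ k * s ^ k / fact k)) (at s within {0..t})"
        unfolding has_real_derivative_iff_has_vector_derivative by (rule subst[rotated])
    qed
    have "z (Suc (Suc k)) t - z (Suc k) t
        = integral {0..t} (\<lambda>s. G s (z (Suc k) s) - G s (z k s))"
      unfolding zS[of "Suc k"] zS[of k t]
      using integral_diff[OF int[OF zc[of "Suc k"] Suc.prems] int[OF zc[of k] Suc.prems]] by simp
    also have "norm \<dots> \<le> integral {0..t} (\<lambda>s. L * (M * L ^ k * s ^ k / fact k))"
    proof (rule integral_norm_bound_integral)
      show "(\<lambda>s. G s (z (Suc k) s) - G s (z k s)) integrable_on {0..t}"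
        by (intro integrable_diff int zc Suc.prems)
      show "(\<lambda>s. L * (M * L ^ k * s ^ k / fact k)) integrable_on {0..t}"
        using i by (auto simp: integrable_on_def)
      fix s assume s: "s \<in> {0..t}"
      then have s1: "s \<in> {0..1}" using Suc.prems by auto
      have "norm (G s (z (Suc k) s) - G s (z k s)) \<le> L * norm (z (Suc k) s - z k s)"
        by (rule lipschitz_on_normD[OF lip[OF s1]]) auto
      also have "\<dots> \<le> L * (M * L ^ k * s ^ k / fact k)"
        by (intro mult_left_mono Suc.IH s1 L0)
      finally show "norm (G s (z (Suc k) s) - G s (z k s)) \<le> L * (M * L ^ k * s ^ k / fact k)" .
    qed
    also have "\<dots> = M * L ^ Suc k * t ^ Suc k / fact (Suc k)"
      by (subst integral_unique[OF i]) simp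
    finally show ?case .
  qed
  have step': "norm (z (Suc k) t - z k t) \<le> M * (L ^ k / fact k)" if "t \<in> {0..1}" for k t
  proof -
    have "M * L ^ k * t ^ k / fact k \<le> M * L ^ k * 1 / fact k"
      using that L0 M0 by (intro divide_right_mono mult_left_mono power_le_one) auto
    then show ?thesis using step[OF that, of k] by simp
  qed
  have summ: "summable (\<lambda>k. M * (L ^ k / fact k))"
    by (intro summable_mult) (use summable_exp[of L] in \<open>simp add: divide_inverse_commute\<close>)
  have "\<exists>w. uniform_limit {0..1} (\<lambda>n t. \<Sum>k<n. z (Suc k) t - z k t) w sequentially"
    by (rule exI, rule Weierstrass_m_test[OF _ summ], rule step')
  then obtain w where "uniform_limit {0..1} (\<lambda>n t. \<Sum>k<n. z (Suc k) t - z k t) w sequentially"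
    by (elim exE)
  then have w: "uniform_limit {0..1} (\<lambda>n t. z n t - u) w sequentially"
    by (simp only: sum_lessThan_telescope[where f = "\<lambda>k. z k _"] z0)
  define y where "y = (\<lambda>t. u + w t)"
  have "uniform_limit {0..1} (\<lambda>n t. u + (z n t - u)) y sequentially"
    unfolding y_def by (intro uniform_limit_intros w)
  then have y: "uniform_limit {0..1} z y sequentially" by simp
  have yc: "continuous_on {0..1} y"
    by (rule uniform_limit_theorem[OF _ y]) (auto simp: zc)
  have Gy: "uniform_limit {0..1} (\<lambda>n s. G s (z n s)) (\<lambda>s. G s (y s)) sequentially"
  proof (rule uniform_limitI)
    fix e :: real assume e: "e > 0"
    \<comment> \<open>\<open>L + 1\<close> replaces \<open>L\<close>, which may be 0.\<close>
    have "\<forall>\<^sub>F n in sequentially. \<forall>s\<in>{0..1}. dist (z n s) (y s) < e / (L + 1)"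
      using uniform_limitD[OF y] e L0 by auto
    then show "\<forall>\<^sub>F n in sequentially. \<forall>s\<in>{0..1}. dist (G s (z n s)) (G s (y s)) < e"
    proof eventually_elim
      case (elim n)
      show ?case
      proof
        fix s :: real assume s: "s \<in> {0..1}"
        have "dist (G s (z n s)) (G s (y s)) \<le> L * dist (z n s) (y s)"
          by (rule lipschitz_onD[OF lip[OF s]]) auto
        also have "\<dots> \<le> (L + 1) * dist (z n s) (y s)" by (intro mult_right_mono) auto
        also have "\<dots> < (L + 1) * (e / (L + 1))"
          using elim s L0 by (intro mult_strict_left_mono) auto
        also have "\<dots> = e" using L0 by simp
        finally show "dist (G s (z n s)) (G s (y s)) < e" .
      qed
    qed
  qed
  have yeq: "y t = u + integral {0..t} (\<lambda>s. G s (y s))" if t: "t \<in> {0..1}" for t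
  proof -
    obtain I J where I: "\<And>n. ((\<lambda>s. G s (z n s)) has_integral I n) {0..t}"
      and J: "((\<lambda>s. G s (y s)) has_integral J) {0..t}" and IJ: "I \<longlonglongrightarrow> J"
    proof (rule uniform_limit_integral[where a = 0 and b = t and f = "\<lambda>n s. G s (z n s)"
          and g = "\<lambda>s. G s (y s)" and F = sequentially])
      show "uniform_limit {0..t} (\<lambda>n s. G s (z n s)) (\<lambda>s. G s (y s)) sequentially"
        by (rule uniform_limit_on_subset[OF Gy]) (use t in auto)
      show "continuous_on {0..t} (\<lambda>s. G s (z n s))" for n
        by (rule continuous_on_subset[OF contG[OF zc]]) (use t in auto)
    qed auto
    have "(\<lambda>n. u + I n) \<longlonglongrightarrow> u + J" by (intro tendsto_intros IJ)
    moreover have "u + I n = z (Suc n) t" for n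
      using I[of n] by (simp add: zS integral_unique)
    moreover have "(\<lambda>n. z (Suc n) t) \<longlonglongrightarrow> y t"
      by (rule LIMSEQ_Suc[OF tendsto_uniform_limitI[OF y t]])
    ultimately have "y t = u + J" by (simp add: LIMSEQ_unique)
    then show ?thesis using J by (simp add: integral_unique)
  qed
  show ?thesis
  proof (intro exI[of _ y] conjI ballI)
    show "y 0 = u" using yeq[of 0] by simp
    fix t :: real assume t: "t \<in> {0..1}"
    have "((\<lambda>t. u + integral {0..t} (\<lambda>s. G s (y s))) has_vector_derivative 0 + G t (y t))
        (at t within {0..1})"
      by (intro has_vector_derivative_add has_vector_derivative_const
          integral_has_vector_derivative contG yc t)
    then show "(y has_vector_derivative G t (y t)) (at t within {0..1})"
      unfolding add_0_left by (rule has_vector_derivative_transform[OF t, rotated]) (rule yeq)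
  qed
qed

definition solves_ode :: "(real \<Rightarrow> 'a::real_normed_vector \<Rightarrow> 'a) \<Rightarrow> (real \<Rightarrow> 'a) \<Rightarrow> 'a \<Rightarrow> bool" where
  "solves_ode Y z u \<longleftrightarrow> z 0 = u \<and>
     (\<forall>t\<in>{0..1}. (z has_vector_derivative Y t (z t)) (at t within {0..1}))"

text \<open>Gronwall in differential form: with \<open>w = z - y\<close>, the function
  \<open>exp (- 2 L t) |w|^2\<close> is nonincreasing by Cauchy-Schwarz. The square keeps it
  differentiable where \<open>w\<close> vanishes.\<close>

lemma lipschitz_solutions_diverge:
  fixes z y :: "real \<Rightarrow> 'a::real_inner"
  assumes z: "\<And>t. t \<in> {0..1} \<Longrightarrow> (z has_vector_derivative Y t (z t)) (at t within {0..1})"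
    and y: "\<And>t. t \<in> {0..1} \<Longrightarrow> (y has_vector_derivative Y t (y t)) (at t within {0..1})"
    and lip: "\<And>t. t \<in> {0..1} \<Longrightarrow> L-lipschitz_on S (Y t)"
    and S: "\<And>t. t \<in> {0..1} \<Longrightarrow> z t \<in> S \<and> y t \<in> S"
    and t: "t \<in> {0..1}"
  shows "norm (z t - y t) \<le> exp L * norm (z 0 - y 0)"
proof -
  define w where "w = (\<lambda>t. z t - y t)"
  define q where "q = (\<lambda>t. exp (- 2 * L * t) * (w t \<bullet> w t))"
  have L0: "0 \<le> L" using lip[of 0] by (auto dest: lipschitz_on_nonneg)
  have w: "(w has_derivative (\<lambda>h. h *\<^sub>R (Y t (z t) - Y t (y t)))) (at t within {0..1})"
    if "t \<in> {0..1}" for t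
    unfolding w_def has_vector_derivative_def[symmetric]
    by (intro has_vector_derivative_diff z y that)
  have q: "(q has_real_derivative
      exp (- 2 * L * t) * (2 * (w t \<bullet> (Y t (z t) - Y t (y t))) - 2 * L * (w t \<bullet> w t)))
      (at t within {0..1})" if "t \<in> {0..1}" for t
    unfolding q_def has_field_derivative_def
    by (rule derivative_eq_intros w that refl)+
      (auto simp: algebra_simps inner_commute fun_eq_iff)
  have le: "q t \<le> q 0"
  proof (rule DERIV_nonpos_imp_decreasing_open[where a = 0 and b = t])
    show "0 \<le> t" using t by simp
    have "continuous_on {0..1} q" by (rule DERIV_continuous_on[OF q])
    then show "continuous_on {0..t} q"
      by (rule continuous_on_subset) (use t in auto)
    fix s assume s: "0 < s" "s < t"
    then have s1: "s \<in> {0..1}" "s \<in> interior {0..1}" using t by auto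
    have "w s \<bullet> (Y s (z s) - Y s (y s)) \<le> norm (w s) * norm (Y s (z s) - Y s (y s))"
      by (rule norm_cauchy_schwarz)
    also have "\<dots> \<le> norm (w s) * (L * norm (w s))"
      unfolding w_def using S[OF s1(1)]
      by (intro mult_left_mono lipschitz_on_normD[OF lip[OF s1(1)]]) auto
    also have "\<dots> = L * (w s \<bullet> w s)" by (simp add: dot_square_norm power2_eq_square)
    finally have "exp (- 2 * L * s) * (2 * (w s \<bullet> (Y s (z s) - Y s (y s))) - 2 * L * (w s \<bullet> w s)) \<le> 0"
      by (intro mult_nonneg_nonpos) auto
    with q[OF s1(1)] show "\<exists>y. (q has_real_derivative y) (at s) \<and> y \<le> 0"
      using at_within_interior[OF s1(2)] by auto
  qed
  have "(norm (w t))\<^sup>2 = exp (2 * L * t) * q t"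
    by (simp add: q_def dot_square_norm flip: mult.assoc exp_add)
  also have "\<dots> \<le> exp (2 * L) * q 0"
    using le t L0 by (intro mult_mono) (auto simp: q_def mult_left_le)
  also have "\<dots> = (exp L * norm (w 0))\<^sup>2"
    by (simp add: q_def dot_square_norm power_mult_distrib power2_eq_square flip: exp_add)
  finally have "norm (w t) \<le> exp L * norm (w 0)"
    by (rule power2_le_imp_le) simp
  then show ?thesis by (simp add: w_def)
qed

text \<open>No regularity is asked at the zeros of \<open>\<rho>\<close>, where the field vanishes
  by its bound. The quarter is chosen so that displacements stay below \<open>\<rho> u / 2\<close>,
  the radius of the ball on which a Lipschitz constant is given.\<close>

locale controlled_field =
  fixes Y :: "real \<Rightarrow> 'a::euclidean_space \<Rightarrow> 'a" and \<rho> :: "'a \<Rightarrow> real"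
  assumes ctrl_nonneg: "0 \<le> \<rho> u"
    and ctrl_lipschitz: "\<bar>\<rho> u - \<rho> v\<bar> \<le> norm (u - v)"
    and field_bound: "t \<in> {0..1} \<Longrightarrow> norm (Y t u) \<le> \<rho> u / 4"
    and field_cont: "continuous_on ({0..1} \<times> {u. 0 < \<rho> u}) (\<lambda>(t, u). Y t u)"
    and field_lipschitz: "0 < \<rho> u \<Longrightarrow> \<exists>L. \<forall>t\<in>{0..1}. L-lipschitz_on (cball u (\<rho> u / 2)) (Y t)"
begin

lemma ctrl_pos_on_cball: "0 < \<rho> u \<Longrightarrow> v \<in> cball u (\<rho> u / 2) \<Longrightarrow> 0 < \<rho> v"
  using ctrl_lipschitz[of u v] by (simp add: dist_norm)

text \<open>Let \<open>m\<close> be the largest displacement. Along the solution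
  \<open>\<rho>\<close> is at most \<open>\<rho> u + m\<close>, so the speed bound gives
  \<open>m \<le> (\<rho> u + m) / 4\<close>, that is \<open>m \<le> \<rho> u / 3\<close>.\<close>

lemma solution_displacement:
  assumes z: "solves_ode Y z u" and t: "t \<in> {0..1}"
  shows "norm (z t - u) \<le> \<rho> u / 3"
proof -
  have zd: "(z has_vector_derivative Y t (z t)) (at t within {0..1})" if "t \<in> {0..1}" for t
    using z that by (auto simp: solves_ode_def)
  have "continuous_on {0..1} z"
    using zd by (rule continuous_on_vector_derivative)
  then have "continuous_on {0..1} (\<lambda>t. norm (z t - u))"
    by (intro continuous_intros)
  then obtain T where T: "T \<in> {0..1}" "\<And>s. s \<in> {0..1} \<Longrightarrow> norm (z s - u) \<le> norm (z T - u)"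
    using continuous_attains_sup[of "{0..1::real}" "\<lambda>t. norm (z t - u)"] by auto
  have "norm (z T - z 0) \<le> ((\<rho> u + norm (z T - u)) / 4) * \<bar>T - 0\<bar>"
  proof (rule vector_derivative_bound_interval[OF zd])
    fix s :: real assume s: "s \<in> {0..1}"
    show "norm (Y s (z s)) \<le> (\<rho> u + norm (z T - u)) / 4"
      using field_bound[OF s, of "z s"] ctrl_lipschitz[of "z s" u] T(2)[OF s]
      unfolding abs_le_iff by simp
  qed (use T in auto)
  also have "\<dots> \<le> (\<rho> u + norm (z T - u)) / 4"
    using T ctrl_nonneg[of u] by (intro mult_left_le) auto
  finally have "norm (z T - u) \<le> \<rho> u / 3"
    using z by (simp add: solves_ode_def)
  then show ?thesis using T(2)[OF t] by simp
qed

text \<open>Composed with the closest-point map \<open>P\<close> of the ball of radius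
  \<open>\<rho> u / 2\<close>, the field becomes globally Lipschitz and bounded. The resulting
  solution never leaves that ball, where \<open>P\<close> is the identity.\<close>

lemma solution_exists: "\<exists>z. solves_ode Y z u"
proof (cases "\<rho> u = 0")
  case True
  then have "Y t u = 0" if "t \<in> {0..1}" for t using field_bound[OF that, of u] by simp
  then show ?thesis unfolding solves_ode_def
    by (intro exI[of _ "\<lambda>t. u"]) simp
next
  case False
  then have pos: "0 < \<rho> u" using ctrl_nonneg[of u] by simp
  let ?B = "cball u (\<rho> u / 2)"
  define P where "P = closest_point ?B"
  have B: "convex ?B" "closed ?B" "?B \<noteq> {}" using pos by auto
  have PB: "P v \<in> ?B" for v unfolding P_def by (rule closest_point_in_set) (use B in auto)
  have Pid: "P v = v" if "v \<in> ?B" for v using that unfolding P_def by (rule closest_point_self)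
  obtain L where L: "\<And>t. t \<in> {0..1} \<Longrightarrow> L-lipschitz_on ?B (Y t)"
    using field_lipschitz[OF pos] by blast
  have P_pos: "0 < \<rho> (P v)" for v by (rule ctrl_pos_on_cball[OF pos PB])
  \<comment> \<open>On the ball \<open>\<rho>\<close> is at most \<open>3 / 2 * \<rho> u\<close>; a
    quarter of this is \<open>3 / 8 * \<rho> u\<close>, still below the radius.\<close>
  have bound: "norm (Y t (P v)) \<le> 3 / 8 * \<rho> u" if "t \<in> {0..1}" for t v
    using field_bound[OF that, of "P v"] ctrl_lipschitz[of u "P v"] PB[of v]
    by (simp add: dist_norm)
  have "\<exists>z. z 0 = u \<and> (\<forall>t\<in>{0..1}. (z has_vector_derivative Y t (P (z t))) (at t within {0..1}))"
  proof (rule picard_lindelof_lipschitz)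
    have "continuous_on ({0..1} \<times> UNIV) ((\<lambda>(t, u). Y t u) \<circ> (\<lambda>tv. (fst tv, P (snd tv))))"
    proof (rule continuous_on_compose)
      show "continuous_on ({0..1} \<times> UNIV) (\<lambda>tv::real \<times> 'a. (fst tv, P (snd tv)))"
        unfolding P_def
        by (intro continuous_on_Pair continuous_on_fst continuous_on_id
            continuous_on_compose2[OF continuous_on_closest_point[OF B, of UNIV]] continuous_on_snd) auto
      show "continuous_on ((\<lambda>tv. (fst tv, P (snd tv))) ` ({0..1} \<times> UNIV)) (\<lambda>(t, u). Y t u)"
        by (rule continuous_on_subset[OF field_cont]) (use P_pos in auto)
    qed
    then show "continuous_on ({0..1} \<times> UNIV) (\<lambda>(t, v). Y t (P v))"
      by (simp add: comp_def case_prod_unfold)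
    show "L-lipschitz_on UNIV (\<lambda>v. Y t (P v))" if "t \<in> {0..1}" for t
    proof (rule lipschitz_onI)
      fix v w
      have "dist (Y t (P v)) (Y t (P w)) \<le> L * dist (P v) (P w)"
        by (rule lipschitz_onD[OF L[OF that] PB PB])
      also have "\<dots> \<le> L * dist v w"
        unfolding P_def using lipschitz_on_nonneg[OF L[OF that]]
        by (intro mult_left_mono closest_point_lipschitz B)
      finally show "dist (Y t (P v)) (Y t (P w)) \<le> L * dist v w" .
    qed (rule lipschitz_on_nonneg[OF L[OF that]])
    show "norm (Y t (P v)) \<le> 3 / 8 * \<rho> u" if "t \<in> {0..1}" for t v by (rule bound[OF that])
  qed
  then obtain z where z0: "z 0 = u"
    and zd: "\<And>t. t \<in> {0..1} \<Longrightarrow> (z has_vector_derivative Y t (P (z t))) (at t within {0..1})"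
    by blast
  have "P (z t) = z t" if t: "t \<in> {0..1}" for t
  proof -
    have "norm (z t - z 0) \<le> 3 / 8 * \<rho> u * \<bar>t - 0\<bar>"
      by (rule vector_derivative_bound_interval[OF zd]) (use bound t in auto)
    also have "\<dots> \<le> 3 / 8 * \<rho> u" using t pos by (intro mult_left_le) auto
    also have "\<dots> \<le> \<rho> u / 2" using pos by simp
    finally show ?thesis by (intro Pid) (simp add: z0 dist_norm norm_minus_commute)
  qed
  then have "solves_ode Y z u" unfolding solves_ode_def using z0 zd by auto
  then show ?thesis by blast
qed

text \<open>Starting within \<open>\<rho> u / 16\<close> of \<open>u\<close>, a solution stays
  within \<open>\<rho> u * (17 / 48 + 1 / 16) < \<rho> u / 2\<close> of \<open>u\<close>, hence in
  the ball with a common Lipschitz constant.\<close>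

lemma solutions_diverge_locally:
  assumes pos: "0 < \<rho> u"
  shows "\<exists>C>0. \<forall>v w z y t. norm (v - u) \<le> \<rho> u / 16 \<and> norm (w - u) \<le> \<rho> u / 16 \<and>
    solves_ode Y z v \<and> solves_ode Y y w \<and> t \<in> {0..1} \<longrightarrow> norm (z t - y t) \<le> C * norm (v - w)"
proof -
  obtain L where L: "\<And>t. t \<in> {0..1} \<Longrightarrow> L-lipschitz_on (cball u (\<rho> u / 2)) (Y t)"
    using field_lipschitz[OF pos] by blast
  have near: "z t \<in> cball u (\<rho> u / 2)"
    if "norm (v - u) \<le> \<rho> u / 16" "solves_ode Y z v" "t \<in> {0..1}" for v z t
  proof -
    have "norm (z t - u) \<le> norm (z t - v) + norm (v - u)" using norm_triangle_ineq[of "z t - v" "v - u"] by simp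
    moreover have "norm (z t - v) \<le> \<rho> v / 3" by (rule solution_displacement that)+
    ultimately show ?thesis
      using that(1) ctrl_lipschitz[of v u] unfolding mem_cball dist_norm norm_minus_commute[of u]
      by argo
  qed
  have "norm (z t - y t) \<le> exp L * norm (v - w)"
    if v: "norm (v - u) \<le> \<rho> u / 16" and w: "norm (w - u) \<le> \<rho> u / 16"
      and z: "solves_ode Y z v" and y: "solves_ode Y y w" and t: "t \<in> {0..1}" for v w z y t
  proof -
    have "norm (z t - y t) \<le> exp L * norm (z 0 - y 0)"
    proof (rule lipschitz_solutions_diverge[where Y = Y and S = "cball u (\<rho> u / 2)"])
      show "z t \<in> cball u (\<rho> u / 2) \<and> y t \<in> cball u (\<rho> u / 2)" if "t \<in> {0..1}" for t
        using near[OF v z that] near[OF w y that] ..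
      show "(z has_vector_derivative Y t (z t)) (at t within {0..1})"
        "(y has_vector_derivative Y t (y t)) (at t within {0..1})" if "t \<in> {0..1}" for t
        using z y that unfolding solves_ode_def by blast+
    qed (rule L t; assumption)+
    then show "norm (z t - y t) \<le> exp L * norm (v - w)"
      using z y by (simp add: solves_ode_def)
  qed
  then show ?thesis by (meson exp_gt_zero)
qed

lemma solution_unique:
  assumes "solves_ode Y z u" "solves_ode Y y u" "t \<in> {0..1}"
  shows "z t = y t"
proof (cases "\<rho> u = 0")
  case True
  then show ?thesis
    using solution_displacement[OF assms(1,3)] solution_displacement[OF assms(2,3)] by simp
next
  case False
  then have "0 < \<rho> u" using ctrl_nonneg[of u] by simp
  then obtain C where C: "\<forall>v w z y t. norm (v - u) \<le> \<rho> u / 16 \<and> norm (w - u) \<le> \<rho> u / 16 \<and>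
      solves_ode Y z v \<and> solves_ode Y y w \<and> t \<in> {0..1} \<longrightarrow> norm (z t - y t) \<le> C * norm (v - w)"
    using solutions_diverge_locally by blast
  have "norm (z t - y t) \<le> C * norm (u - u)"
    by (rule C[rule_format]) (use assms \<open>0 < \<rho> u\<close> in simp)
  then show ?thesis by simp
qed

section \<open>The time-one map and its inverse\<close>

definition time_one :: "'a \<Rightarrow> 'a" where
  "time_one u = (SOME z. solves_ode Y z u) 1"

lemma time_one_eq: "solves_ode Y z u \<Longrightarrow> time_one u = z 1"
  unfolding time_one_def
  by (rule solution_unique[OF someI[where P = "\<lambda>z. solves_ode Y z u"]]) auto

lemma time_one_displacement: "norm (time_one u - u) \<le> \<rho> u / 3"
  using solution_exists[of u] solution_displacement[of _ u 1] by (auto simp: time_one_eq)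

text \<open>Two regimes: at a zero \<open>u\<close> of \<open>\<rho>\<close> the displacement bound
  gives \<open>|time_one v - u| \<le> 2 |v - u|\<close> although the field need not be Lipschitz
  there; elsewhere the local Gronwall estimate applies.\<close>

lemma time_one_continuous: "continuous_on UNIV time_one"
proof (intro continuous_at_imp_continuous_on ballI)
  fix u :: 'a
  show "isCont time_one u"
  proof (cases "\<rho> u = 0")
    case True
    then have fix_u: "time_one u = u" using time_one_displacement[of u] by simp
    have "norm (time_one v - u) \<le> 2 * norm (v - u)" for v
    proof -
      have "norm (time_one v - u) \<le> norm (time_one v - v) + norm (v - u)"
        using norm_triangle_ineq[of "time_one v - v" "v - u"] by simp
      then show ?thesis
        using time_one_displacement[of v] ctrl_lipschitz[of v u] True by simp
    qed
    then have "\<forall>\<^sub>F v in at u. norm (time_one v - u) \<le> norm (v - u) * 2"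
      by (intro always_eventually allI) (simp add: mult.commute)
    moreover have "((\<lambda>v. norm (v - u) * 2) \<longlongrightarrow> 0) (at u)"
      by (auto intro!: tendsto_eq_intros)
    ultimately have "((\<lambda>v. time_one v - u) \<longlongrightarrow> 0) (at u)"
      by (rule Lim_null_comparison)
    then show ?thesis unfolding isCont_def fix_u by (rule LIM_zero_cancel)
  next
    case False
    then have pos: "0 < \<rho> u" using ctrl_nonneg[of u] by simp
    then obtain C where C: "\<forall>v w z y t. norm (v - u) \<le> \<rho> u / 16 \<and> norm (w - u) \<le> \<rho> u / 16 \<and>
        solves_ode Y z v \<and> solves_ode Y y w \<and> t \<in> {0..1} \<longrightarrow> norm (z t - y t) \<le> C * norm (v - w)"
      using solutions_diverge_locally by blast
    have *: "norm (time_one v - time_one u) \<le> norm (v - u) * C" if v: "norm (v - u) \<le> \<rho> u / 16" for v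
    proof -
      obtain z y where zy: "solves_ode Y z v" "solves_ode Y y u" using solution_exists by metis
      have "norm (z 1 - y 1) \<le> C * norm (v - u)"
        by (rule C[rule_format]) (use zy v pos in simp)
      then show ?thesis using zy by (simp add: time_one_eq mult.commute)
    qed
    have "\<forall>\<^sub>F v in at u. dist v u < \<rho> u / 16"
      using pos by (intro eventually_at_ball'[of "\<rho> u / 16" u UNIV, simplified, THEN eventually_mono]) (auto simp: dist_commute)
    then have "\<forall>\<^sub>F v in at u. norm (time_one v - time_one u) \<le> norm (v - u) * C"
      by eventually_elim (use * in \<open>auto simp: dist_norm\<close>)
    moreover have "((\<lambda>v. norm (v - u) * C) \<longlongrightarrow> 0) (at u)"
      by (auto intro!: tendsto_eq_intros)
    ultimately have "((\<lambda>v. time_one v - time_one u) \<longlongrightarrow> 0) (at u)"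
      by (rule Lim_null_comparison)
    then show ?thesis unfolding isCont_def by (rule LIM_zero_cancel)
  qed
qed

lemma reversed_field: "controlled_field (\<lambda>t u. - Y (1 - t) u) \<rho>"
proof
  show "continuous_on ({0..1} \<times> {u. 0 < \<rho> u}) (\<lambda>(t, u). - Y (1 - t) u)"
  proof -
    have "continuous_on ({0..1} \<times> {u. 0 < \<rho> u}) ((\<lambda>(t, u). Y t u) \<circ> (\<lambda>tu::real \<times> 'a. (1 - fst tu, snd tu)))"
    proof (rule continuous_on_compose)
      show "continuous_on ({0..1} \<times> {u. 0 < \<rho> u}) (\<lambda>tu::real \<times> 'a. (1 - fst tu, snd tu))"
        by (intro continuous_on_Pair continuous_on_diff continuous_on_const continuous_on_fst
            continuous_on_snd continuous_on_id)
      show "continuous_on ((\<lambda>tu::real \<times> 'a. (1 - fst tu, snd tu)) ` ({0..1} \<times> {u. 0 < \<rho> u})) (\<lambda>(t, u). Y t u)"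
        by (rule continuous_on_subset[OF field_cont]) auto
    qed
    then show ?thesis
      by (auto simp: comp_def case_prod_unfold intro: continuous_on_minus)
  qed
  show "\<exists>L. \<forall>t\<in>{0..1}. L-lipschitz_on (cball u (\<rho> u / 2)) (\<lambda>u. - Y (1 - t) u)" if "0 < \<rho> u" for u
    proof -
    obtain L where L: "\<And>t. t \<in> {0..1} \<Longrightarrow> L-lipschitz_on (cball u (\<rho> u / 2)) (Y t)"
      using field_lipschitz[OF \<open>0 < \<rho> u\<close>] by blast
    have "L-lipschitz_on (cball u (\<rho> u / 2)) (\<lambda>u. - Y (1 - t) u)" if "t \<in> {0..1}" for t
      using L[of "1 - t"] that by simp
    then show ?thesis by blast
  qed
  show "norm (- Y (1 - t) u) \<le> \<rho> u / 4" if "t \<in> {0..1}" for t u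
    using field_bound[of "1 - t" u] that by simp
qed (rule ctrl_nonneg ctrl_lipschitz)+

lemma solves_ode_reversed:
  assumes "solves_ode Y z u"
  shows "solves_ode (\<lambda>t u. - Y (1 - t) u) (\<lambda>t. z (1 - t)) (z 1)"
  unfolding solves_ode_def
proof (intro conjI ballI)
  fix t :: real assume t: "t \<in> {0..1}"
  have img: "(\<lambda>t. 1 - t) ` {0..1::real} = {0..1}"
    by (simp add: image_diff_atLeastAtMost)
  have "(z has_derivative (\<lambda>h. h *\<^sub>R Y (1 - t) (z (1 - t)))) (at (1 - t) within (\<lambda>t. 1 - t) ` {0..1})"
    unfolding img using assms t by (auto simp: solves_ode_def has_vector_derivative_def)
  moreover have "((\<lambda>t. 1 - t) has_derivative (\<lambda>h. - h)) (at t within {0..1::real})"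
    by (auto intro!: derivative_eq_intros)
  ultimately have "((\<lambda>t. z (1 - t)) has_derivative (\<lambda>h. (- h) *\<^sub>R Y (1 - t) (z (1 - t))))
      (at t within {0..1})"
    using diff_chain_within[of "\<lambda>t. 1 - t" "\<lambda>h. - h" t "{0..1}" z "\<lambda>h. h *\<^sub>R Y (1 - t) (z (1 - t))"]
    by (simp add: comp_def)
  then show "((\<lambda>t. z (1 - t)) has_vector_derivative - Y (1 - t) (z (1 - t))) (at t within {0..1})"
    by (simp add: has_vector_derivative_def)
qed simp

text \<open>The inverse is the time-one map of the time-reversed field, which satisfies the same
  assumptions with the same \<open>\<rho>\<close>; its continuity needs no separate
  argument.\<close>

lemma time_one_homeomorphism: "\<exists>\<psi>. homeomorphism UNIV UNIV time_one \<psi>"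
proof -
  interpret rev: controlled_field "\<lambda>t u. - Y (1 - t) u" \<rho> by (rule reversed_field)
  have 1: "rev.time_one (time_one u) = u" for u
  proof -
    obtain z where z: "solves_ode Y z u" using solution_exists by blast
    then show ?thesis
      using rev.time_one_eq[OF solves_ode_reversed[OF z]] time_one_eq[OF z]
      by (simp add: solves_ode_def)
  qed
  have 2: "time_one (rev.time_one u) = u" for u
  proof -
    obtain z where z: "solves_ode (\<lambda>t u. - Y (1 - t) u) z u" using rev.solution_exists by blast
    then show ?thesis
      using time_one_eq[of "\<lambda>t. z (1 - t)" "z 1"] rev.solves_ode_reversed[OF z] rev.time_one_eq[OF z]
      by (simp add: solves_ode_def)
  qed
  have "homeomorphism UNIV UNIV time_one rev.time_one"
    by (rule homeomorphismI) (auto simp: 1 2 time_one_continuous rev.time_one_continuous)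
  then show ?thesis by blast
qed

end

section \<open>Locally Lipschitz maps\<close>

text \<open>Local Lipschitz continuity is the regularity that survives the cut-off:
  \<open>infdist\<close>, norms and clamping to \<open>[0, 1]\<close> preserve it but not
  differentiability. Constants need not be tracked, since compactness recovers a uniform
  one.\<close>

definition lipschitz_near :: "('a::metric_space \<Rightarrow> 'b::metric_space) \<Rightarrow> 'a \<Rightarrow> bool" where
  "lipschitz_near f x \<longleftrightarrow> (\<exists>e>0. \<exists>L. L-lipschitz_on (ball x e) f)"

named_theorems lipschitz_near_intros

lemma lipschitz_nearI: "0 < e \<Longrightarrow> L-lipschitz_on (ball x e) f \<Longrightarrow> lipschitz_near f x"
  unfolding lipschitz_near_def by blast

lemma lipschitz_near_global: "L-lipschitz_on UNIV f \<Longrightarrow> lipschitz_near f x"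
  by (rule lipschitz_nearI[of 1]) (auto intro: lipschitz_on_subset)

lemma lipschitz_near_const [lipschitz_near_intros]: "lipschitz_near (\<lambda>_. c) x"
  by (rule lipschitz_near_global[OF lipschitz_on_constant])

lemma lipschitz_near_bounded_linear: "bounded_linear f \<Longrightarrow> lipschitz_near f x"
proof -
  assume f: "bounded_linear f"
  then interpret bounded_linear f .
  obtain K where K: "0 \<le> K" "\<And>v. norm (f v) \<le> norm v * K" using nonneg_bounded by blast
  have "K-lipschitz_on UNIV f"
    by (rule lipschitz_onI) (use K in \<open>auto simp: dist_norm mult.commute simp flip: diff\<close>)
  then show ?thesis by (rule lipschitz_near_global)
qed

lemma lipschitz_near_imp_continuous:
  assumes "lipschitz_near f x"
  shows "continuous (at x) f"
proof -
  obtain e L where e: "0 < e" and L: "L-lipschitz_on (ball x e) f"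
    using assms unfolding lipschitz_near_def by blast
  have "continuous_on (ball x e) f" by (rule lipschitz_on_continuous_on[OF L])
  then show ?thesis using e by (simp add: continuous_on_eq_continuous_at)
qed

lemma lipschitz_near_imp_tendsto: "lipschitz_near f x \<Longrightarrow> (f \<longlongrightarrow> f x) (nhds x)"
  using lipschitz_near_imp_continuous[of f x]
  by (simp add: continuous_within tendsto_at_iff_tendsto_nhds)

lemma lipschitz_near_cong:
  assumes f: "lipschitz_near f x" and eq: "\<forall>\<^sub>F y in nhds x. f y = g y"
  shows "lipschitz_near g x"
proof -
  obtain e L where e: "0 < e" and L: "L-lipschitz_on (ball x e) f"
    using f unfolding lipschitz_near_def by blast
  obtain d where d: "0 < d" "\<And>y. dist y x < d \<Longrightarrow> f y = g y"
    using eq by (auto simp: eventually_nhds_metric)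
  show ?thesis
  proof (rule lipschitz_nearI)
    show "0 < min e d" using e d by simp
    show "L-lipschitz_on (ball x (min e d)) g"
    proof (rule lipschitz_on_transform)
      show "L-lipschitz_on (ball x (min e d)) f" by (rule lipschitz_on_subset[OF L]) auto
      show "g y = f y" if "y \<in> ball x (min e d)" for y
        using that d(2)[of y] by (simp add: dist_commute)
    qed
  qed
qed

lemma lipschitz_near_compose:
  assumes f: "lipschitz_near f x" and g: "lipschitz_near g (f x)"
  shows "lipschitz_near (\<lambda>y. g (f y)) x"
proof -
  obtain e L where e: "0 < e" and L: "L-lipschitz_on (ball x e) f"
    using f unfolding lipschitz_near_def by blast
  obtain d M where d: "0 < d" and M: "M-lipschitz_on (ball (f x) d) g"
    using g unfolding lipschitz_near_def by blast
  have "\<forall>\<^sub>F y in nhds x. dist (f y) (f x) < d"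
    using lipschitz_near_imp_continuous[OF f] d
    by (metis continuous_within tendsto_at_iff_tendsto_nhds tendstoD)
  then obtain c where c: "0 < c" "\<And>y. dist y x < c \<Longrightarrow> dist (f y) (f x) < d"
    by (auto simp: eventually_nhds_metric)
  show ?thesis
  proof (rule lipschitz_nearI)
    show "0 < min e c" using e c by simp
    show "(M * L)-lipschitz_on (ball x (min e c)) (\<lambda>y. g (f y))"
    proof (rule lipschitz_on_compose2[where f = f and g = g, OF lipschitz_on_subset[OF L] lipschitz_on_subset[OF M]])
      show "f ` ball x (min e c) \<subseteq> ball (f x) d"
        using c(2) by (auto simp: dist_commute)
    qed auto
  qed
qed

lemma lipschitz_near_linear_image:
  "bounded_linear g \<Longrightarrow> lipschitz_near f x \<Longrightarrow> lipschitz_near (\<lambda>y. g (f y)) x"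
  by (rule lipschitz_near_compose[OF _ lipschitz_near_bounded_linear])

lemma lipschitz_near_common:
  assumes "lipschitz_near f x" "lipschitz_near g x"
  obtains e L M where "0 < e" "L-lipschitz_on (ball x e) f" "M-lipschitz_on (ball x e) g"
proof -
  obtain e L where e: "0 < e" and L: "L-lipschitz_on (ball x e) f"
    using assms unfolding lipschitz_near_def by blast
  obtain d M where d: "0 < d" and M: "M-lipschitz_on (ball x d) g"
    using assms unfolding lipschitz_near_def by blast
  show ?thesis
    by (rule that[of "min e d" L M])
      (use e d in \<open>auto intro: lipschitz_on_subset[OF L] lipschitz_on_subset[OF M]\<close>)
qed

lemma lipschitz_near_add [lipschitz_near_intros]:
  fixes f g :: "'a::metric_space \<Rightarrow> 'b::real_normed_vector"
  assumes "lipschitz_near f x" "lipschitz_near g x"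
  shows "lipschitz_near (\<lambda>y. f y + g y) x"
  by (rule lipschitz_near_common[OF assms]) (auto intro!: lipschitz_nearI lipschitz_on_add)

lemma lipschitz_near_minus [lipschitz_near_intros]:
  fixes f :: "'a::metric_space \<Rightarrow> 'b::real_normed_vector"
  shows "lipschitz_near f x \<Longrightarrow> lipschitz_near (\<lambda>y. - f y) x"
  unfolding lipschitz_near_def by simp

lemma lipschitz_near_sum [lipschitz_near_intros]:
  fixes f :: "'i \<Rightarrow> 'a::metric_space \<Rightarrow> 'b::real_normed_vector"
  shows "(\<And>i. i \<in> I \<Longrightarrow> lipschitz_near (f i) x) \<Longrightarrow> lipschitz_near (\<lambda>y. \<Sum>i\<in>I. f i y) x"
  by (induction I rule: infinite_finite_induct) (auto intro!: lipschitz_near_intros)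

lemma (in bounded_bilinear) lipschitz_near_prod:
  assumes "lipschitz_near f x" "lipschitz_near g x"
  shows "lipschitz_near (\<lambda>y. prod (f y) (g y)) x"
proof -
  obtain e L M where e: "0 < e" and L: "L-lipschitz_on (ball x e) f"
    and M: "M-lipschitz_on (ball x e) g" by (rule lipschitz_near_common[OF assms])
  obtain K where K: "0 \<le> K" "\<And>a b. norm (prod a b) \<le> norm a * norm b * K"
    using nonneg_bounded by blast
  define A where "A = norm (f x) + L * e"
  define B where "B = norm (g x) + M * e"
  have x: "x \<in> ball x e" using e by simp
  have L0: "0 \<le> L" and M0: "0 \<le> M"
    using L M lipschitz_on_nonneg by auto
  have A: "norm (f y) \<le> A" if "y \<in> ball x e" for y
  proof -
    have "dist (f y) (f x) \<le> L * dist y x" by (rule lipschitz_onD[OF L that x])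
    also have "\<dots> \<le> L * e" using that L0 by (intro mult_left_mono) (auto simp: dist_commute)
    finally show ?thesis
      using norm_triangle_ineq2[of "f y" "f x"] by (simp add: A_def dist_norm)
  qed
  have B: "norm (g y) \<le> B" if "y \<in> ball x e" for y
  proof -
    have "dist (g y) (g x) \<le> M * dist y x" by (rule lipschitz_onD[OF M that x])
    also have "\<dots> \<le> M * e" using that M0 by (intro mult_left_mono) (auto simp: dist_commute)
    finally show ?thesis
      using norm_triangle_ineq2[of "g y" "g x"] by (simp add: B_def dist_norm)
  qed
  have AB: "0 \<le> A" "0 \<le> B" using A[OF x] B[OF x] norm_ge_zero order_trans by blast+
  have "(A * M * K + L * B * K)-lipschitz_on (ball x e) (\<lambda>y. prod (f y) (g y))"
  proof (rule lipschitz_onI)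
    fix y z assume y: "y \<in> ball x e" and z: "z \<in> ball x e"
    have "prod (f y) (g y) - prod (f z) (g z) = prod (f y) (g y - g z) + prod (f y - f z) (g z)"
      by (simp add: diff_left diff_right)
    then have "dist (prod (f y) (g y)) (prod (f z) (g z))
        \<le> norm (prod (f y) (g y - g z)) + norm (prod (f y - f z) (g z))"
      by (metis dist_norm norm_triangle_ineq)
    also have "\<dots> \<le> norm (f y) * norm (g y - g z) * K + norm (f y - f z) * norm (g z) * K"
      by (intro add_mono K(2))
    also have "\<dots> \<le> A * (M * dist y z) * K + (L * dist y z) * B * K"
      using lipschitz_onD[OF L y z] lipschitz_onD[OF M y z] A[OF y] B[OF z] K(1) AB L0 M0
      by (intro add_mono mult_right_mono mult_mono) (auto simp: dist_norm)
    also have "\<dots> = (A * M * K + L * B * K) * dist y z" by (simp add: algebra_simps)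
    finally show "dist (prod (f y) (g y)) (prod (f z) (g z)) \<le> (A * M * K + L * B * K) * dist y z" .
  qed (use AB L0 M0 K in simp)
  then show ?thesis by (rule lipschitz_nearI[OF e])
qed

lemmas lipschitz_near_scaleR [lipschitz_near_intros] =
  bounded_bilinear.lipschitz_near_prod[OF bounded_bilinear_scaleR]

lemmas lipschitz_near_mult [lipschitz_near_intros] =
  bounded_bilinear.lipschitz_near_prod[OF bounded_bilinear_mult]

lemmas lipschitz_near_inner [lipschitz_near_intros] =
  bounded_bilinear.lipschitz_near_prod[OF bounded_bilinear_inner]

lemma lipschitz_near_diff [lipschitz_near_intros]:
  fixes f g :: "'a::metric_space \<Rightarrow> 'b::real_normed_vector"
  assumes "lipschitz_near f x" "lipschitz_near g x"
  shows "lipschitz_near (\<lambda>y. f y - g y) x"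
  using lipschitz_near_add[OF assms(1) lipschitz_near_minus[OF assms(2)]] by simp

lemma lipschitz_near_prod_set [lipschitz_near_intros]:
  fixes f :: "'i \<Rightarrow> 'a::metric_space \<Rightarrow> real"
  shows "(\<And>i. i \<in> I \<Longrightarrow> lipschitz_near (f i) x) \<Longrightarrow> lipschitz_near (\<lambda>y. \<Prod>i\<in>I. f i y) x"
  by (induction I rule: infinite_finite_induct) (auto intro!: lipschitz_near_intros)

lemma lipschitz_near_power [lipschitz_near_intros]:
  fixes f :: "'a::metric_space \<Rightarrow> real"
  shows "lipschitz_near f x \<Longrightarrow> lipschitz_near (\<lambda>y. f y ^ n) x"
  by (induction n) (auto intro!: lipschitz_near_intros)

lemma lipschitz_near_inverse:
  fixes c :: real
  assumes "c \<noteq> 0"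
  shows "lipschitz_near inverse c"
proof (rule lipschitz_nearI)
  define e where "e = \<bar>c\<bar> / 2"
  show "0 < e" using assms by (simp add: e_def)
  show "(1 / e\<^sup>2)-lipschitz_on (ball c e) inverse"
  proof (rule lipschitz_onI)
    fix y z assume "y \<in> ball c e" "z \<in> ball c e"
    then have yz: "e \<le> \<bar>y\<bar>" "e \<le> \<bar>z\<bar>" by (auto simp: dist_real_def e_def abs_if split: if_splits)
    then have nz: "y \<noteq> 0" "z \<noteq> 0" using \<open>0 < e\<close> by auto
    have "dist (inverse y) (inverse z) = dist y z / (\<bar>y\<bar> * \<bar>z\<bar>)"
      using nz by (simp add: dist_real_def inverse_diff_inverse abs_mult divide_inverse abs_minus_commute)
    also have "\<dots> \<le> dist y z / e\<^sup>2"
      unfolding power2_eq_square using yz \<open>0 < e\<close>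
      by (intro divide_left_mono mult_mono mult_pos_pos) auto
    finally show "dist (inverse y) (inverse z) \<le> 1 / e\<^sup>2 * dist y z" by simp
  qed simp
qed

lemma lipschitz_near_divide:
  fixes f g :: "'a::metric_space \<Rightarrow> real"
  assumes "lipschitz_near f x" "lipschitz_near g x" "g x \<noteq> 0"
  shows "lipschitz_near (\<lambda>y. f y / g y) x"
  unfolding divide_inverse
  by (intro lipschitz_near_mult assms lipschitz_near_compose[OF assms(2)] lipschitz_near_inverse)

lemma lipschitz_near_norm [lipschitz_near_intros]:
  fixes f :: "'a::metric_space \<Rightarrow> 'b::real_normed_vector"
  assumes "lipschitz_near f x"
  shows "lipschitz_near (\<lambda>y. norm (f y)) x"
proof (rule lipschitz_near_compose[OF assms], rule lipschitz_near_global)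
  show "1-lipschitz_on UNIV (norm :: 'b \<Rightarrow> real)"
    by (rule lipschitz_onI) (auto simp: dist_norm norm_triangle_ineq3)
qed

lemma lipschitz_near_clamp [lipschitz_near_intros]:
  fixes f :: "'a::metric_space \<Rightarrow> real"
  assumes "lipschitz_near f x"
  shows "lipschitz_near (\<lambda>y. min 1 (max 0 (f y))) x"
proof (rule lipschitz_near_compose[OF assms], rule lipschitz_near_global)
  show "1-lipschitz_on UNIV (\<lambda>t::real. min 1 (max 0 t))"
    by (rule lipschitz_onI) (auto simp: dist_real_def)
qed

lemma lipschitz_near_infdist [lipschitz_near_intros]:
  fixes f :: "'a::metric_space \<Rightarrow> 'b::metric_space"
  assumes "lipschitz_near f x"
  shows "lipschitz_near (\<lambda>y. infdist (f y) S) x"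
proof (rule lipschitz_near_compose[OF assms], rule lipschitz_near_global)
  show "1-lipschitz_on UNIV (\<lambda>y. infdist y S)"
    by (rule lipschitz_onI) (auto simp: dist_real_def infdist_triangle_abs)
qed

lemma lipschitz_near_det:
  fixes A :: "'a::metric_space \<Rightarrow> real^'n^'n"
  assumes "\<And>i j. lipschitz_near (\<lambda>y. A y $ i $ j) x"
  shows "lipschitz_near (\<lambda>y. det (A y)) x"
  unfolding det_def by (intro lipschitz_near_intros assms)

lemma lipschitz_near_imp_lipschitz_on_compact:
  fixes f :: "'a::metric_space \<Rightarrow> 'b::metric_space"
  assumes "compact K" "\<And>x. x \<in> K \<Longrightarrow> lipschitz_near f x"
  shows "\<exists>L. L-lipschitz_on K f"
proof -
  \<comment> \<open>\<open>f\<close> is viewed as a family over the one-point time set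
    \<open>{0}\<close>, for which the passage from local to uniform constants on compact sets is
    known.\<close>
  have ll: "local_lipschitz {0::real} K (\<lambda>_. f)"
    unfolding local_lipschitz_def
  proof (intro ballI)
    fix x and t :: real assume "x \<in> K"
    then obtain e L where e: "0 < e" and L: "L-lipschitz_on (ball x e) f"
      using assms(2) unfolding lipschitz_near_def by blast
    have "L-lipschitz_on (cball x (e / 2) \<inter> K) f"
      by (rule lipschitz_on_subset[OF L]) (use e in auto)
    then show "\<exists>u>0. \<exists>L. \<forall>t\<in>cball t u \<inter> {0}. L-lipschitz_on (cball x u \<inter> K) f"
      using e by (intro exI[of _ "e / 2"] conjI exI[of _ L]) auto
  qed
  obtain L where "\<And>t. t \<in> {0::real} \<Longrightarrow> L-lipschitz_on K f"
    by (rule local_lipschitz_compact_implies_lipschitz[OF ll assms(1)]) auto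
  then show ?thesis by blast
qed

section \<open>Taylor expansion of \<open>C\<^sup>k\<close> maps\<close>

lemma frechet_derivative_cong_open:
  assumes "open W" "x \<in> W" "\<And>y. y \<in> W \<Longrightarrow> f y = g y"
  shows "frechet_derivative f (at x) = frechet_derivative g (at x)"
proof -
  have "(f has_derivative D) (at x) \<longleftrightarrow> (g has_derivative D) (at x)" for D
    using assms has_derivative_transform_within_open[of f D x UNIV W g]
      has_derivative_transform_within_open[of g D x UNIV W f] by auto
  then show ?thesis by (simp add: frechet_derivative_def)
qed

lemma differentiable_cong_open:
  assumes "open W" "x \<in> W" "\<And>y. y \<in> W \<Longrightarrow> f y = g y"
  shows "f differentiable (at x) \<longleftrightarrow> g differentiable (at x)"
  unfolding differentiable_def
  using assms has_derivative_transform_within_open[of f _ x UNIV W g]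
      has_derivative_transform_within_open[of g _ x UNIV W f] by metis

lemma Ck_on_cong:
  assumes "open W" "\<And>y. y \<in> W \<Longrightarrow> f y = g y"
  shows "Ck_on k f W \<longleftrightarrow> Ck_on k g W"
  using assms(2)
proof (induction k arbitrary: f g)
  case 0
  then show ?case by (simp cong: continuous_on_cong)
next
  case (Suc k)
  have "frechet_derivative f (at x) v = frechet_derivative g (at x) v" if "x \<in> W" for x v
    using frechet_derivative_cong_open[OF assms(1) that Suc.prems] by simp
  then have "Ck_on k (\<lambda>x. frechet_derivative f (at x) v) W \<longleftrightarrow>
      Ck_on k (\<lambda>x. frechet_derivative g (at x) v) W" for v
    by (rule Suc.IH)
  then show ?case using differentiable_cong_open[OF assms(1) _ Suc.prems] by simp
qed

lemma diag_derivative_cong: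
  assumes "open W" "a \<in> W" "\<And>y. y \<in> W \<Longrightarrow> f y = g y"
  shows "diag_derivative k f a v = diag_derivative k g a v"
  using assms(3)
proof (induction k arbitrary: f g)
  case 0
  then show ?case using assms(2) by simp
next
  case (Suc k)
  have "frechet_derivative f (at x) v = frechet_derivative g (at x) v" if "x \<in> W" for x
    using frechet_derivative_cong_open[OF assms(1) that Suc.prems] by simp
  then show ?case unfolding diag_derivative.simps by (rule Suc.IH)
qed

lemma frechet_derivative_linear_combination:
  assumes "\<And>i. i \<in> I \<Longrightarrow> f i differentiable (at x)"
  shows "(\<lambda>x. \<Sum>i\<in>I. c i *\<^sub>R f i x) differentiable (at x)"
    and "frechet_derivative (\<lambda>x. \<Sum>i\<in>I. c i *\<^sub>R f i x) (at x) v
      = (\<Sum>i\<in>I. c i *\<^sub>R frechet_derivative (f i) (at x) v)"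
proof -
  have "((\<lambda>x. \<Sum>i\<in>I. c i *\<^sub>R f i x) has_derivative
      (\<lambda>v. \<Sum>i\<in>I. c i *\<^sub>R frechet_derivative (f i) (at x) v)) (at x)"
    using assms by (intro has_derivative_sum has_derivative_scaleR_right)
      (simp add: frechet_derivative_works)
  then show "(\<lambda>x. \<Sum>i\<in>I. c i *\<^sub>R f i x) differentiable (at x)"
    "frechet_derivative (\<lambda>x. \<Sum>i\<in>I. c i *\<^sub>R f i x) (at x) v
      = (\<Sum>i\<in>I. c i *\<^sub>R frechet_derivative (f i) (at x) v)"
    by (auto simp: differentiable_def dest: frechet_derivative_at[symmetric])
qed

lemma Ck_on_linear_combination:
  assumes "open W" "\<And>i. i \<in> I \<Longrightarrow> Ck_on k (f i) W"
  shows "Ck_on k (\<lambda>x. \<Sum>i\<in>I. c i *\<^sub>R f i x) W"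
  using assms(2)
proof (induction k arbitrary: f)
  case 0
  then show ?case by (auto intro!: continuous_intros)
next
  case (Suc k)
  have "Ck_on k (\<lambda>x. \<Sum>i\<in>I. c i *\<^sub>R frechet_derivative (f i) (at x) v) W" for v
    using Suc by simp
  moreover have "frechet_derivative (\<lambda>x. \<Sum>i\<in>I. c i *\<^sub>R f i x) (at x) v
      = (\<Sum>i\<in>I. c i *\<^sub>R frechet_derivative (f i) (at x) v)" if "x \<in> W" for x v
    by (rule frechet_derivative_linear_combination) (use Suc.prems that in simp)
  ultimately have "Ck_on k (\<lambda>x. frechet_derivative (\<lambda>x. \<Sum>i\<in>I. c i *\<^sub>R f i x) (at x) v) W" for v
    by (subst Ck_on_cong[OF assms(1)]) auto
  then show ?case
    using Suc.prems by (auto intro: frechet_derivative_linear_combination(1))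
qed

text \<open>The form with an indexed sum covers the difference \<open>g - f\<close>, the expansion
  of a direction in the basis and, over a one-element index set, a scalar multiple.\<close>

lemma diag_derivative_linear_combination:
  assumes "open W" "a \<in> W" "\<And>i. i \<in> I \<Longrightarrow> Ck_on k (f i) W"
  shows "diag_derivative k (\<lambda>x. \<Sum>i\<in>I. c i *\<^sub>R f i x) a v
    = (\<Sum>i\<in>I. c i *\<^sub>R diag_derivative k (f i) a v)"
  using assms(3)
proof (induction k arbitrary: f)
  case 0
  then show ?case by simp
next
  case (Suc k)
  have "frechet_derivative (\<lambda>x. \<Sum>i\<in>I. c i *\<^sub>R f i x) (at x) v
      = (\<Sum>i\<in>I. c i *\<^sub>R frechet_derivative (f i) (at x) v)" if "x \<in> W" for x
    by (rule frechet_derivative_linear_combination) (use Suc.prems that in simp)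
  then have "diag_derivative k (\<lambda>x. frechet_derivative (\<lambda>x. \<Sum>i\<in>I. c i *\<^sub>R f i x) (at x) v) a v
      = diag_derivative k (\<lambda>x. \<Sum>i\<in>I. c i *\<^sub>R frechet_derivative (f i) (at x) v) a v"
    by (rule diag_derivative_cong[OF assms(1,2)])
  also have "\<dots> = (\<Sum>i\<in>I. c i *\<^sub>R diag_derivative k (\<lambda>x. frechet_derivative (f i) (at x) v) a v)"
    by (rule Suc.IH) (use Suc.prems in simp)
  finally show ?case by simp
qed

lemma Ck_on_diff:
  assumes "open W" "Ck_on k f W" "Ck_on k g W"
  shows "Ck_on k (\<lambda>x. g x - f x) W"
  using Ck_on_linear_combination[OF assms(1), of UNIV k "\<lambda>b. if b then g else f" "\<lambda>b. if b then 1 else -1"]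
    assms by (simp add: UNIV_bool)

lemma diag_derivative_diff:
  assumes "open W" "a \<in> W" "Ck_on k f W" "Ck_on k g W"
  shows "diag_derivative k (\<lambda>x. g x - f x) a v = diag_derivative k g a v - diag_derivative k f a v"
  using diag_derivative_linear_combination[OF assms(1,2), of UNIV k "\<lambda>b. if b then g else f" "\<lambda>b. if b then 1 else -1"]
    assms by (simp add: UNIV_bool)

lemma Ck_on_Suc_imp: "Ck_on (Suc k) f W \<Longrightarrow> Ck_on k f W"
proof (induction k arbitrary: f)
  case 0
  then show ?case
    by (auto intro!: continuous_at_imp_continuous_on differentiable_imp_continuous_within)
next
  case (Suc k)
  then show ?case unfolding Ck_on.simps(2)[of "Suc k"] by auto
qed

lemma Ck_on_le: "Ck_on k f W \<Longrightarrow> j \<le> k \<Longrightarrow> Ck_on j f W"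
  by (induction k) (auto simp: le_Suc_eq simp del: Ck_on.simps dest: Ck_on_Suc_imp)

lemma Ck_on_subset: "Ck_on k f W \<Longrightarrow> V \<subseteq> W \<Longrightarrow> Ck_on k f V"
  by (induction k arbitrary: f) (auto intro: continuous_on_subset)

text \<open>Induction on \<open>k\<close>: the direction of the first differentiation is expanded in
  the basis, and the other \<open>k\<close> differentiations fall on the finitely many maps
  \<open>x \<mapsto> D f(x) b\<close>. Full multilinearity of the higher derivatives is not
  involved.\<close>

lemma diag_derivative_bound_on_compact:
  assumes W: "open W" "compact K" "K \<subseteq> W" and f: "Ck_on k f W"
  obtains M where "0 \<le> M" "\<And>a v. a \<in> K \<Longrightarrow> norm (diag_derivative k f a v) \<le> M * norm v ^ k"
proof -
  have "\<exists>M\<ge>0. \<forall>a\<in>K. \<forall>v. norm (diag_derivative k f a v) \<le> M * norm v ^ k"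
    using f
  proof (induction k arbitrary: f)
    case 0
    then have "compact (f ` K)"
      using assms by (auto intro: compact_continuous_image continuous_on_subset)
    then obtain M where M: "\<And>y. y \<in> f ` K \<Longrightarrow> norm y \<le> M"
      by (meson bounded_iff compact_imp_bounded)
    show ?case by (intro exI[of _ "max M 0"]) (auto intro: M order_trans[OF _ max.cobounded1])
  next
    case (Suc k)
    have "\<forall>b. \<exists>M\<ge>0. \<forall>a\<in>K. \<forall>v. norm (diag_derivative k (\<lambda>x. frechet_derivative f (at x) b) a v)
        \<le> M * norm v ^ k"
      using Suc by simp
    then obtain M where M: "\<And>b. 0 \<le> M b" "\<And>b a v. a \<in> K \<Longrightarrow>
        norm (diag_derivative k (\<lambda>x. frechet_derivative f (at x) b) a v) \<le> M b * norm v ^ k"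
      by metis
    have "norm (diag_derivative (Suc k) f a v) \<le> (\<Sum>b\<in>Basis. M b) * norm v ^ Suc k" if a: "a \<in> K" for a v
    proof -
      have lin: "frechet_derivative f (at x) v = (\<Sum>b\<in>Basis. (v \<bullet> b) *\<^sub>R frechet_derivative f (at x) b)"
        if "x \<in> W" for x
      proof -
        interpret bounded_linear "frechet_derivative f (at x)"
          using Suc.prems that by (auto intro: has_derivative_bounded_linear simp: frechet_derivative_works)
        have "frechet_derivative f (at x) v = frechet_derivative f (at x) (\<Sum>b\<in>Basis. (v \<bullet> b) *\<^sub>R b)"
          by (simp only: euclidean_representation)
        then show ?thesis by (simp only: sum scaleR)
      qed
      have "diag_derivative (Suc k) f a v
          = diag_derivative k (\<lambda>x. \<Sum>b\<in>Basis. (v \<bullet> b) *\<^sub>R frechet_derivative f (at x) b) a v"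
        unfolding diag_derivative.simps
        by (rule diag_derivative_cong[OF assms(1)]) (use lin a assms in auto)
      also have "\<dots> = (\<Sum>b\<in>Basis. (v \<bullet> b) *\<^sub>R diag_derivative k (\<lambda>x. frechet_derivative f (at x) b) a v)"
        by (rule diag_derivative_linear_combination[OF assms(1)]) (use Suc.prems a assms in auto)
      also have "norm \<dots> \<le> (\<Sum>b\<in>Basis. norm v * (M b * norm v ^ k))"
      proof (rule sum_norm_le)
        fix b :: 'a assume "b \<in> Basis"
        then show "norm ((v \<bullet> b) *\<^sub>R diag_derivative k (\<lambda>x. frechet_derivative f (at x) b) a v)
            \<le> norm v * (M b * norm v ^ k)"
          unfolding norm_scaleR using M(2)[OF a] Basis_le_norm[of b v]
          by (intro mult_mono) auto
      qed
      finally show ?thesis by (simp add: sum_distrib_right algebra_simps sum_distrib_left)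
    qed
    then show ?case by (intro exI[of _ "\<Sum>b\<in>Basis. M b"]) (auto intro: sum_nonneg M)
  qed
  then show ?thesis using that by blast
qed

lemma diag_derivative_has_vector_derivative:
  assumes "open W" "a + s *\<^sub>R v \<in> W" "Ck_on (Suc i) f W"
  shows "((\<lambda>s. diag_derivative i f (a + s *\<^sub>R v) v) has_vector_derivative
    diag_derivative (Suc i) f (a + s *\<^sub>R v) v) (at s)"
  using assms(3)
proof (induction i arbitrary: f)
  case 0
  have f: "(f has_derivative frechet_derivative f (at (a + s *\<^sub>R v))) (at (a + s *\<^sub>R v))"
    using 0 assms(2) by (simp add: frechet_derivative_works[symmetric])
  then interpret bounded_linear "frechet_derivative f (at (a + s *\<^sub>R v))"
    by (rule has_derivative_bounded_linear)
  have "((\<lambda>s. f (a + s *\<^sub>R v)) has_derivative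
      (\<lambda>h. frechet_derivative f (at (a + s *\<^sub>R v)) (h *\<^sub>R v))) (at s)"
    by (rule has_derivative_compose[where f = "\<lambda>s. a + s *\<^sub>R v" and f' = "\<lambda>h. h *\<^sub>R v" and g = f, OF _ f])
      (auto intro!: derivative_eq_intros)
  then show ?case by (simp add: has_vector_derivative_def scaleR)
next
  case (Suc i)
  have "Ck_on (Suc i) (\<lambda>x. frechet_derivative f (at x) v) W"
    using Suc.prems by (simp only: Ck_on.simps(2)[of "Suc i"]) 
  from Suc.IH[OF this] show ?case by simp
qed

text \<open>Integral form of the remainder on the segment from \<open>a\<close> to
  \<open>a + v\<close>. Only the order in \<open>v\<close> matters later, so the kernel
  \<open>(1 - s)^(k-1) / (k-1)!\<close> is estimated by 1.\<close>

lemma taylor_remainder_bound: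
  fixes f :: "'a::euclidean_space \<Rightarrow> 'b::banach"
  assumes W: "open W" "compact K" "K \<subseteq> W" and f: "Ck_on k f W" and "1 \<le> k"
    and M: "\<And>a v. a \<in> K \<Longrightarrow> norm (diag_derivative k f a v) \<le> M * norm v ^ k" "0 \<le> M"
    and seg: "\<And>s. s \<in> {0..1} \<Longrightarrow> a + s *\<^sub>R v \<in> K"
  shows "norm (f (a + v) - (\<Sum>i<k. (1 / fact i) *\<^sub>R diag_derivative i f a v)) \<le> M * norm v ^ k"
proof -
  define D where "D = (\<lambda>i s. diag_derivative i f (a + s *\<^sub>R v) v)"
  have der: "(D i has_vector_derivative D (Suc i) s) (at s within {0..1})"
    if "i < k" "0 \<le> s" "s \<le> 1" for i s
    unfolding D_def
    by (rule has_vector_derivative_at_within, rule diag_derivative_has_vector_derivative[OF W(1)])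
      (use seg[of s] that W(3) Ck_on_le[OF f, of "Suc i"] in auto)
  have "((\<lambda>s. ((1 - s) ^ (k - 1) / fact (k - 1)) *\<^sub>R D k s) has_integral
      D 0 1 - (\<Sum>i<k. ((1 - 0) ^ i / fact i) *\<^sub>R D i 0)) {0..1}"
    by (rule Taylor_has_integral[of k D "D 0"]) (use \<open>1 \<le> k\<close> der in auto)
  then have "((\<lambda>s. ((1 - s) ^ (k - 1) / fact (k - 1)) *\<^sub>R D k s) has_integral
      f (a + v) - (\<Sum>i<k. (1 / fact i) *\<^sub>R diag_derivative i f a v)) (cbox 0 (1::real))"
    by (simp add: D_def)
  then have "norm (f (a + v) - (\<Sum>i<k. (1 / fact i) *\<^sub>R diag_derivative i f a v))
      \<le> M * norm v ^ k * measure lborel (cbox 0 (1::real))"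
  proof (rule has_integral_bound[rotated])
    fix s :: real assume s: "s \<in> cbox 0 1"
    have "norm (((1 - s) ^ (k - 1) / fact (k - 1)) *\<^sub>R D k s)
        = (1 - s) ^ (k - 1) / fact (k - 1) * norm (D k s)"
      using s by (simp add: abs_mult)
    also have "\<dots> \<le> 1 * (M * norm v ^ k)"
    proof (rule mult_mono)
      have "(1 - s) ^ (k - 1) \<le> 1" using s by (intro power_le_one) auto
      also have "1 \<le> (fact (k - 1) :: real)" by (rule fact_ge_1)
      finally show "(1 - s) ^ (k - 1) / fact (k - 1) \<le> 1" by simp
      show "norm (D k s) \<le> M * norm v ^ k" unfolding D_def using seg[of s] s by (intro M) auto
    qed auto
    finally show "norm (((1 - s) ^ (k - 1) / fact (k - 1)) *\<^sub>R D k s) \<le> M * norm v ^ k" by simp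
  qed (use M in auto)
  then show ?thesis by simp
qed

lemma C1_imp_lipschitz_near:
  assumes W: "open W" "x \<in> W" and f: "Ck_on (Suc 0) f W"
  shows "lipschitz_near f x"
proof -
  obtain e where e: "0 < e" "cball x e \<subseteq> W" using W open_contains_cball by blast
  have "\<exists>M\<ge>0. \<forall>a\<in>cball x e. \<forall>v. norm (frechet_derivative f (at a) v) \<le> M * norm v"
    by (rule diag_derivative_bound_on_compact[OF W(1) compact_cball e(2) f]) auto
  then obtain M where M0: "0 \<le> M"
    and M: "\<forall>a\<in>cball x e. \<forall>v. norm (frechet_derivative f (at a) v) \<le> M * norm v"
    by blast
  have "M-lipschitz_on (cball x e) f"
  proof (rule bounded_derivative_imp_lipschitz)
    fix y assume y: "y \<in> cball x e"
    then have "f differentiable (at y)" using f e by auto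
    then show "(f has_derivative frechet_derivative f (at y)) (at y within cball x e)"
      unfolding frechet_derivative_works by (rule has_derivative_at_withinI)
    show "onorm (frechet_derivative f (at y)) \<le> M"
      by (rule onorm_le) (rule M[rule_format, OF y])
  qed (use M0 in auto)
  then have "M-lipschitz_on (ball x e) f" by (rule lipschitz_on_subset) auto
  then show ?thesis by (rule lipschitz_nearI[OF e(1)])
qed

section \<open>Flatness from equality of jets\<close>

text \<open>The jet of \<open>h = g - f\<close> at \<open>a\<close> vanishes as a polynomial, so its
  part of degree below \<open>k\<close> is minus its top term and hence \<open>O(|v|^k)\<close>,
  like the Taylor remainder. The homogeneous parts need not be separated.\<close>

lemma equal_jets_imp_flat:
  fixes f g :: "'a::euclidean_space \<Rightarrow> 'b::banach"
  assumes W: "open W" "cball 0 R \<subseteq> W" and f: "Ck_on k f W" and g: "Ck_on k g W" and "1 \<le> k"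
  shows "\<exists>C\<ge>0. \<forall>a v. norm a \<le> R \<and> norm (a + v) \<le> R \<and> taylor_jet k f a = taylor_jet k g a \<longrightarrow>
    norm (g (a + v) - f (a + v)) \<le> C * norm v ^ k"
proof -
  define h where "h = (\<lambda>x. g x - f x)"
  have h: "Ck_on k h W" unfolding h_def by (rule Ck_on_diff[OF W(1) f g])
  obtain M where M: "0 \<le> M" "\<And>a v. a \<in> cball 0 R \<Longrightarrow> norm (diag_derivative k h a v) \<le> M * norm v ^ k"
    by (rule diag_derivative_bound_on_compact[OF W(1) compact_cball W(2) h], rule that)
  have "norm (h (a + v)) \<le> (2 * M) * norm v ^ k"
    if a: "norm a \<le> R" "norm (a + v) \<le> R" "taylor_jet k f a = taylor_jet k g a" for a v
  proof -
    have aW: "a \<in> W" using a W by auto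
    have "taylor_jet k h a v = taylor_jet k g a v - taylor_jet k f a v"
      unfolding taylor_jet_def h_def sum_subtractf[symmetric]
      by (rule sum.cong) (use aW Ck_on_le[OF f] Ck_on_le[OF g] in
        \<open>auto simp: diag_derivative_diff[OF W(1)] scaleR_diff_right\<close>)
    then have "(\<Sum>i<k. (1 / fact i) *\<^sub>R diag_derivative i h a v) + (1 / fact k) *\<^sub>R diag_derivative k h a v = 0"
      using fun_cong[OF a(3), of v] unfolding taylor_jet_def lessThan_Suc_atMost[symmetric] by simp
    then have *: "(\<Sum>i<k. (1 / fact i) *\<^sub>R diag_derivative i h a v) = - ((1 / fact k) *\<^sub>R diag_derivative k h a v)"
      by (simp add: eq_neg_iff_add_eq_0)
    have seg: "a + s *\<^sub>R v \<in> cball 0 R" if "s \<in> {0..1}" for s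
    proof -
      have "(1 - s) *\<^sub>R a + s *\<^sub>R (a + v) \<in> cball 0 R"
        using a that by (intro convexD) auto
      then show ?thesis by (simp add: algebra_simps)
    qed
    have "norm (h (a + v) - (\<Sum>i<k. (1 / fact i) *\<^sub>R diag_derivative i h a v)) \<le> M * norm v ^ k"
      by (rule taylor_remainder_bound[OF W(1) compact_cball W(2) h \<open>1 \<le> k\<close> M(2,1) seg])
    moreover have "norm ((1 / fact k) *\<^sub>R diag_derivative k h a v) \<le> 1 * (M * norm v ^ k)"
    proof -
      have "norm ((1 / fact k) *\<^sub>R diag_derivative k h a v) = 1 / fact k * norm (diag_derivative k h a v)"
        by simp
      also have "\<dots> \<le> 1 * (M * norm v ^ k)"
        by (intro mult_mono M) (use a fact_ge_1[of k, where 'a = real] in auto)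
      finally show ?thesis .
    qed
    ultimately show ?thesis
      unfolding * using norm_triangle_ineq4[of "h (a + v) + (1 / fact k) *\<^sub>R diag_derivative k h a v"
          "(1 / fact k) *\<^sub>R diag_derivative k h a v"] by simp
  qed
  then show ?thesis using M(1) by (intro exI[of _ "2 * M"]) (auto simp: h_def)
qed

text \<open>Equivalence of norms on polynomials of bounded degree, with \<open>A\<close> depending
  on the degree but not on the vector coefficients; the induction lowers the degree by rescaling the
  variable.\<close>

lemma linear_coefficient_bound:
  "\<exists>A\<ge>0. \<forall>(c :: nat \<Rightarrow> 'b::real_normed_vector) B.
    (\<forall>s\<in>{0..1}. norm (\<Sum>i\<le>Suc N. s ^ i *\<^sub>R c i) \<le> B) \<longrightarrow> norm (c 1) \<le> A * B"
proof (induction N)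
  case 0
  have "norm (c 1) \<le> 2 * B" if B: "\<forall>s\<in>{0..1::real}. norm (\<Sum>i\<le>Suc 0. s ^ i *\<^sub>R c i) \<le> B"
    for c :: "nat \<Rightarrow> 'b" and B
    using B[rule_format, of 0] B[rule_format, of 1] norm_triangle_ineq4[of "c 0 + c 1" "c 0"] by simp
  then show ?case by (intro exI[of _ 2]) auto
next
  case (Suc N)
  then obtain A where A: "0 \<le> A" "\<And>(c :: nat \<Rightarrow> 'b) B.
      (\<forall>s\<in>{0..1}. norm (\<Sum>i\<le>Suc N. s ^ i *\<^sub>R c i) \<le> B) \<Longrightarrow> norm (c 1) \<le> A * B" by blast
  let ?q = "(2::real) ^ Suc (Suc N)"
  have "norm (c 1) \<le> (A * (1 + ?q)) * B"
    if B: "\<forall>s\<in>{0..1::real}. norm (\<Sum>i\<le>Suc (Suc N). s ^ i *\<^sub>R c i) \<le> B" for c :: "nat \<Rightarrow> 'b" and B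
  proof -
    define P where "P = (\<lambda>s::real. \<Sum>i\<le>Suc (Suc N). s ^ i *\<^sub>R c i)"
    define e where "e = (\<lambda>i. (1 - ?q / 2 ^ i) *\<^sub>R c i)"
    \<comment> \<open>Passing from \<open>P s\<close> to \<open>P s - 2\<^sup>n P (s / 2)\<close> kills the coefficient of degree \<open>n\<close>.\<close>
    have e: "(\<Sum>i\<le>Suc N. s ^ i *\<^sub>R e i) = P s - ?q *\<^sub>R P (s / 2)" for s
    proof -
      have "P s - ?q *\<^sub>R P (s / 2) = (\<Sum>i\<le>Suc (Suc N). s ^ i *\<^sub>R e i)"
        unfolding P_def e_def scaleR_sum_right sum_subtractf[symmetric]
        by (rule sum.cong) (auto simp: power_divide algebra_simps)
      also have "\<dots> = (\<Sum>i\<le>Suc N. s ^ i *\<^sub>R e i)"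
        by (subst sum.atMost_Suc) (simp add: e_def)
      finally show ?thesis by simp
    qed
    have "norm (e 1) \<le> A * (B + ?q * B)"
    proof (rule A(2), intro ballI)
      fix s :: real assume s: "s \<in> {0..1}"
      have "norm (P s - ?q *\<^sub>R P (s / 2)) \<le> norm (P s) + ?q * norm (P (s / 2))"
        using norm_triangle_ineq4[of "P s" "?q *\<^sub>R P (s / 2)"] by simp
      also have "\<dots> \<le> B + ?q * B"
        unfolding P_def using s by (intro add_mono mult_left_mono B[rule_format]) simp_all
      finally show "norm (\<Sum>i\<le>Suc N. s ^ i *\<^sub>R e i) \<le> B + ?q * B" unfolding e .
    qed
    \<comment> \<open>The linear coefficient survives the elimination: it is multiplied by
      \<open>1 - 2^(N+1)\<close>, of absolute value at least 1.\<close>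
    moreover have "norm (c 1) \<le> norm (e 1)"
    proof -
      have "1 \<le> (2::real) ^ N" by simp
      moreover have "?q / 2 ^ 1 = 2 * 2 ^ N" by simp
      ultimately have "1 \<le> \<bar>1 - ?q / 2 ^ 1\<bar>" by linarith
      then have "1 * norm (c 1) \<le> \<bar>1 - ?q / 2 ^ 1\<bar> * norm (c 1)" by (rule mult_right_mono) simp
      then show ?thesis by (simp add: e_def)
    qed
    ultimately show ?thesis by (simp add: algebra_simps)
  qed
  then show ?case using A(1) by (intro exI[of _ "A * (1 + ?q)"]) auto
qed

text \<open>
  On a segment of length \<open>\<rho> u\<close> starting at \<open>u\<close>, the Taylor polynomial of \<open>h\<close> at \<open>u\<close> has size
  \<open>O(\<rho> u ^ k)\<close>, hence so has its linear coefficient. This route needs neither the symmetry of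
  higher derivatives nor the jets of the derivative.
\<close>

lemma flat_imp_derivative_flat:
  fixes h :: "'a::euclidean_space \<Rightarrow> 'b::banach"
  assumes W: "open W" "cball 0 R \<subseteq> W" and h: "Ck_on k h W" and k: "2 \<le> k"
    and flat: "\<And>w. norm w \<le> R \<Longrightarrow> norm (h w) \<le> C * \<rho> w ^ k" and "0 \<le> C"
    and \<rho>: "\<And>w. 0 \<le> \<rho> w" "\<And>w v. \<bar>\<rho> w - \<rho> v\<bar> \<le> norm (w - v)"
  shows "\<exists>A\<ge>0. \<forall>u v. norm u \<le> R / 2 \<and> 0 < \<rho> u \<and> \<rho> u \<le> R / 2 \<and> norm v \<le> 1 \<longrightarrow>
    norm (frechet_derivative h (at u) v) \<le> A * \<rho> u ^ (k - 1)"
proof -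
  obtain M where M: "0 \<le> M" "\<And>a v. a \<in> cball 0 R \<Longrightarrow> norm (diag_derivative k h a v) \<le> M * norm v ^ k"
    by (rule diag_derivative_bound_on_compact[OF W(1) compact_cball W(2) h], rule that)
  obtain A where A: "0 \<le> A" "\<And>(c :: nat \<Rightarrow> 'b) B.
      (\<forall>s\<in>{0..1}. norm (\<Sum>i\<le>Suc (k - 2). s ^ i *\<^sub>R c i) \<le> B) \<Longrightarrow> norm (c 1) \<le> A * B"
    using linear_coefficient_bound[of "k - 2", where 'b = 'b] by blast
  let ?B = "C * 2 ^ k + M"
  have "norm (frechet_derivative h (at u) v) \<le> (A * ?B) * \<rho> u ^ (k - 1)"
    if u: "norm u \<le> R / 2" "0 < \<rho> u" "\<rho> u \<le> R / 2" and v: "norm v \<le> 1" for u v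
  proof -
    \<comment> \<open>A step of length at most \<open>\<rho> u\<close> is the longest useful one:
      along it \<open>\<rho>\<close> at most doubles, so the flatness bound remains of order
      \<open>\<rho> u ^ k\<close>.\<close>
    define w where "w = \<rho> u *\<^sub>R v"
    have nw: "norm w \<le> \<rho> u" unfolding w_def using v u by (simp add: mult_left_le)
    have nsw: "norm (s *\<^sub>R w) \<le> \<rho> u" if "s \<in> {0..1}" for s
    proof -
      have "norm (s *\<^sub>R w) \<le> 1 * norm w"
        unfolding norm_scaleR by (rule mult_right_mono) (use that in auto)
      then show ?thesis using nw by simp
    qed
    have inK: "u + s *\<^sub>R w \<in> cball 0 R" if "s \<in> {0..1}" for s
      using norm_triangle_ineq[of u "s *\<^sub>R w"] nsw[OF that] u by simp
    define c where "c = (\<lambda>i. (1 / fact i) *\<^sub>R diag_derivative i h u w)"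
    have "norm (c 1) \<le> A * (?B * \<rho> u ^ k)"
    proof (rule A(2), intro ballI)
      fix s :: real assume s: "s \<in> {0..1}"
      have hom: "diag_derivative i h u (s *\<^sub>R w) = s ^ i *\<^sub>R diag_derivative i h u w" if "i \<le> k" for i
        using Ck_on_le[OF h that] 
      proof (induction i arbitrary: h)
        case (Suc i)
        have "u \<in> W" using inK[of 0] W by auto
        have "frechet_derivative h (at x) (s *\<^sub>R w) = (\<Sum>_\<in>{()}. s *\<^sub>R frechet_derivative h (at x) w)" if "x \<in> W" for x
          using Suc.prems that
          by (auto intro!: linear_cmul linear_frechet_derivative)
        then have "diag_derivative (Suc i) h u (s *\<^sub>R w)
            = diag_derivative i (\<lambda>x. \<Sum>_\<in>{()}. s *\<^sub>R frechet_derivative h (at x) w) u (s *\<^sub>R w)"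
          unfolding diag_derivative.simps by (rule diag_derivative_cong[OF W(1) \<open>u \<in> W\<close>])
        also have "\<dots> = (\<Sum>_\<in>{()}. s *\<^sub>R diag_derivative i (\<lambda>x. frechet_derivative h (at x) w) u (s *\<^sub>R w))"
          by (rule diag_derivative_linear_combination[OF W(1) \<open>u \<in> W\<close>]) (use Suc.prems in simp)
        also have "\<dots> = s ^ Suc i *\<^sub>R diag_derivative (Suc i) h u w"
          using Suc.IH[of "\<lambda>x. frechet_derivative h (at x) w"] Suc.prems by simp
        finally show ?case .
      qed simp
      have "norm (h (u + s *\<^sub>R w) - (\<Sum>i<k. (1 / fact i) *\<^sub>R diag_derivative i h u (s *\<^sub>R w)))
          \<le> M * norm (s *\<^sub>R w) ^ k"
      proof (rule taylor_remainder_bound[OF W(1) compact_cball W(2) h _ M(2,1)])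
        show "u + t *\<^sub>R s *\<^sub>R w \<in> cball 0 R" if "t \<in> {0..1}" for t
          using inK[of "t * s"] that s by (simp add: mult_le_one)
      qed (use k in auto)
      also have "\<dots> \<le> M * \<rho> u ^ k"
        by (intro mult_left_mono power_mono nsw s M) auto
      finally have 1: "norm (h (u + s *\<^sub>R w) - (\<Sum>i<k. (1 / fact i) *\<^sub>R diag_derivative i h u (s *\<^sub>R w)))
          \<le> M * \<rho> u ^ k" .
      have "norm (h (u + s *\<^sub>R w)) \<le> C * \<rho> (u + s *\<^sub>R w) ^ k"
        using inK[OF s] by (intro flat) simp
      also have "\<dots> \<le> C * (2 * \<rho> u) ^ k"
        using \<rho>(2)[of "u + s *\<^sub>R w" u] nsw[OF s]
        by (intro mult_left_mono power_mono \<open>0 \<le> C\<close> \<rho>) auto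
      finally have 2: "norm (h (u + s *\<^sub>R w)) \<le> C * (2 * \<rho> u) ^ k" .
      \<comment> \<open>Since \<open>2 \<le> k\<close>, the degrees up to \<open>Suc (k - 2)\<close>
        are exactly those below \<open>k\<close>. Homogeneity turns the Taylor polynomial in the
        increment \<open>s w\<close> into a polynomial in \<open>s\<close>.\<close>
      have "(\<Sum>i\<le>Suc (k - 2). s ^ i *\<^sub>R c i) = (\<Sum>i<k. (1 / fact i) *\<^sub>R diag_derivative i h u (s *\<^sub>R w))"
        unfolding c_def using k by (intro sum.cong) (auto simp: hom)
      also have "norm \<dots> \<le> C * (2 * \<rho> u) ^ k + M * \<rho> u ^ k"
        using 1 2 norm_triangle_ineq4[of "h (u + s *\<^sub>R w)"
          "h (u + s *\<^sub>R w) - (\<Sum>i<k. (1 / fact i) *\<^sub>R diag_derivative i h u (s *\<^sub>R w))"] by simp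
      also have "\<dots> = ?B * \<rho> u ^ k" by (simp add: power_mult_distrib algebra_simps)
      finally show "norm (\<Sum>i\<le>Suc (k - 2). s ^ i *\<^sub>R c i) \<le> ?B * \<rho> u ^ k" .
    qed
    moreover have "c 1 = \<rho> u *\<^sub>R frechet_derivative h (at u) v"
    proof -
      have "h differentiable (at u)"
        using Ck_on_le[OF h, of "Suc 0"] k inK[of 0] W by auto
      then show ?thesis unfolding c_def w_def
        by (auto intro!: linear_cmul linear_frechet_derivative)
    qed
    \<comment> \<open>The factor \<open>\<rho> u\<close> contained in \<open>w\<close> is cancelled
      here; this is the one order lost by differentiation.\<close>
    ultimately have "\<rho> u * norm (frechet_derivative h (at u) v) \<le> \<rho> u * (A * ?B * \<rho> u ^ (k - 1))"
      using u k by (simp add: power_eq_if[of _ k] algebra_simps)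
    then show ?thesis using u by simp
  qed
  then show ?thesis using A(1) M(1) \<open>0 \<le> C\<close> by (intro exI[of _ "A * ?B"]) auto
qed

section \<open>Solving the linearised equation\<close>

definition gram :: "('p \<Rightarrow> 'a::real_inner) \<Rightarrow> real^'p^'p" where
  "gram a = (\<chi> i j. a i \<bullet> a j)"

text \<open>
  The combination \<open>v\<close> of the \<open>a k\<close> with \<open>a i \<bullet> v = b $ i\<close>, written by Cramer's rule so that its
  regularity in \<open>a\<close> and \<open>b\<close> is visible.
\<close>

definition least_solution :: "('p::finite \<Rightarrow> 'a::real_inner) \<Rightarrow> real^'p \<Rightarrow> 'a" where
  "least_solution a b =
     (\<Sum>k\<in>UNIV. (det (\<chi> i j. if j = k then b $ i else gram a $ i $ j) / det (gram a)) *\<^sub>R a k)"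

lemma gram_mult: "(gram a *v y) $ i = a i \<bullet> (\<Sum>j\<in>UNIV. y $ j *\<^sub>R a j)"
  by (simp add: gram_def matrix_vector_mult_def inner_sum_right mult.commute)

lemma gram_quadratic:
  "(\<Sum>j\<in>UNIV. y $ j *\<^sub>R a j) \<bullet> (\<Sum>j\<in>UNIV. y $ j *\<^sub>R a j) = y \<bullet> (gram a *v y)"
  by (simp add: inner_vec_def[of y] gram_mult inner_sum_left)

text \<open>The quadratic form of the Gram matrix at \<open>y\<close> is the squared norm of the
  combination with coefficients \<open>y\<close>, so \<open>m\<close> makes the kernel trivial. If
  \<open>v\<close> is the solution with coefficients \<open>y\<close>, then
  \<open>|v|^2 = y \<bullet> b \<le> |y| |b| \<le> |v| |b| / m\<close>.\<close>

lemma
  fixes a :: "'p::finite \<Rightarrow> 'a::real_inner"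
  assumes m: "0 < m" "\<And>y :: real^'p. m * norm y \<le> norm (\<Sum>j\<in>UNIV. y $ j *\<^sub>R a j)"
  shows det_gram_nonzero: "det (gram a) \<noteq> 0"
    and least_solution_inner: "a i \<bullet> least_solution a b = b $ i"
    and least_solution_bound: "norm (least_solution a b) \<le> norm b / m"
proof -
  have "y = 0" if "gram a *v y = 0" for y
    using m(2)[of y] gram_quadratic[of y a] that m(1) by (simp add: mult_le_0_iff)
  then have "\<exists>B. B ** gram a = mat 1"
    unfolding matrix_left_invertible_ker by blast
  then show det: "det (gram a) \<noteq> 0"
    using invertible_det_nz invertible_left_inverse by blast
  define y where "y = (\<chi> k. det (\<chi> i j. if j = k then b $ i else gram a $ i $ j) / det (gram a))"
  have y: "gram a *v y = b" using cramer[OF det] y_def by blast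
  have V: "least_solution a b = (\<Sum>j\<in>UNIV. y $ j *\<^sub>R a j)"
    by (simp add: least_solution_def y_def)
  show "a i \<bullet> least_solution a b = b $ i"
    unfolding V gram_mult[symmetric] y ..
  have "(m * norm (least_solution a b)) * norm (least_solution a b) = m * (y \<bullet> b)"
    using gram_quadratic[of y a] y by (simp add: V[symmetric] dot_square_norm power2_eq_square)
  also have "\<dots> \<le> m * norm y * norm b"
    using norm_cauchy_schwarz[of y b] m(1) by simp
  also have "\<dots> \<le> norm (least_solution a b) * norm b"
    unfolding V by (intro mult_right_mono m) auto
  finally have "(m * norm (least_solution a b)) * norm (least_solution a b)
      \<le> norm b * norm (least_solution a b)" by (simp add: mult.commute)
  then have "m * norm (least_solution a b) \<le> norm b"
    by (cases "least_solution a b = 0") auto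
  then show "norm (least_solution a b) \<le> norm b / m"
    using m(1) by (simp add: field_simps)
qed

lemma lipschitz_near_least_solution:
  fixes a :: "'b::metric_space \<Rightarrow> 'p::finite \<Rightarrow> 'a::real_inner"
  assumes a: "\<And>j. lipschitz_near (\<lambda>x. a x j) x" and b: "\<And>i. lipschitz_near (\<lambda>x. b x $ i) x"
    and "det (gram (a x)) \<noteq> 0"
  shows "lipschitz_near (\<lambda>x. least_solution (a x) (b x)) x"
proof -
  have G: "lipschitz_near (\<lambda>x. gram (a x) $ i $ j) x" for i j
    by (simp add: gram_def lipschitz_near_inner a)
  have "lipschitz_near (\<lambda>x. (\<chi> i j. if j = k then b x $ i else gram (a x) $ i $ j) $ i $ j) x" for i j k
    using G b by (cases "j = k") auto
  then show ?thesis
    unfolding least_solution_def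
    by (intro lipschitz_near_sum lipschitz_near_scaleR lipschitz_near_divide lipschitz_near_det a G assms(3))
qed

section \<open>Partial gradients and the Kuo pseudo-distance\<close>

lemma has_derivative_x:
  fixes f :: "(real^'n) \<times> (real^'l) \<Rightarrow> real^'p"
  assumes "f differentiable (at u)"
  shows "((\<lambda>x. f (x, snd u) $ j) has_derivative (\<lambda>v. frechet_derivative f (at u) (v, 0) $ j)) (at (fst u))"
proof -
  have f: "(f has_derivative frechet_derivative f (at u)) (at (fst u, snd u))"
    using assms by (simp add: frechet_derivative_works)
  have "((\<lambda>x. f (x, snd u)) has_derivative (\<lambda>v. frechet_derivative f (at u) (v, 0))) (at (fst u))"
    by (rule has_derivative_compose[where f = "\<lambda>x. (x, snd u)" and f' = "\<lambda>v. (v, 0)", OF _ f])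
      (auto intro!: derivative_eq_intros)
  then show ?thesis by (rule bounded_linear.has_derivative[OF bounded_linear_vec_nth])
qed

lemma linear_eq_inner_sum:
  fixes D :: "'a::euclidean_space \<Rightarrow> real"
  assumes "linear D"
  shows "D v = v \<bullet> (\<Sum>b\<in>Basis. D b *\<^sub>R b)"
proof -
  have "D v = D (\<Sum>b\<in>Basis. (v \<bullet> b) *\<^sub>R b)" by (simp only: euclidean_representation)
  also have "\<dots> = (\<Sum>b\<in>Basis. (v \<bullet> b) * D b)"
    by (simp only: linear_sum[OF assms] linear_cmul[OF assms] real_scaleR_def)
  finally show ?thesis by (simp add: inner_sum_right mult.commute)
qed

lemma grad_x_eq_sum:
  fixes f :: "(real^'n) \<times> (real^'l) \<Rightarrow> real^'p"
  assumes "f differentiable (at u)"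
  shows "grad_x f j u = (\<Sum>b\<in>Basis. (frechet_derivative f (at u) (b, 0) $ j) *\<^sub>R b)"
proof (rule grad_x_eq)
  let ?D = "\<lambda>v. frechet_derivative f (at u) (v, 0) $ j"
  have lin: "linear ?D" by (rule has_derivative_linear[OF has_derivative_x[OF assms]])
  have "?D = (\<lambda>v. v \<bullet> (\<Sum>b\<in>Basis. ?D b *\<^sub>R b))"
    by (rule ext) (rule linear_eq_inner_sum[OF lin])
  then show "GDERIV (\<lambda>x. f (x, snd u) $ j) (fst u) :> (\<Sum>b\<in>Basis. ?D b *\<^sub>R b)"
    unfolding gderiv_def by (rule has_derivative_eq_rhs[OF has_derivative_x[OF assms]])
qed

lemma grad_x_inner:
  fixes f :: "(real^'n) \<times> (real^'l) \<Rightarrow> real^'p"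
  assumes "f differentiable (at u)"
  shows "v \<bullet> grad_x f j u = frechet_derivative f (at u) (v, 0) $ j"
  unfolding grad_x_eq_sum[OF assms]
  using linear_eq_inner_sum[OF has_derivative_linear[OF has_derivative_x[OF assms]], of v j] by (rule sym)

text \<open>The coordinate formula shows the gradient as a linear expression in values of
  \<open>D f\<close>, which are of class C^1. The formula holds only on \<open>W\<close>, hence the
  passage through equality near \<open>u\<close>.\<close>

lemma lipschitz_near_grad_x:
  fixes f :: "(real^'n) \<times> (real^'l) \<Rightarrow> real^'p"
  assumes W: "open W" "u \<in> W" and f: "Ck_on 2 f W"
  shows "lipschitz_near (grad_x f j) u"
proof -
  have f2: "\<And>x. x \<in> W \<Longrightarrow> f differentiable (at x)"
    "\<And>v. Ck_on (Suc 0) (\<lambda>x. frechet_derivative f (at x) v) W"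
    using f by (auto simp: numeral_2_eq_2)
  have "lipschitz_near (\<lambda>x. frechet_derivative f (at x) (b, 0) $ j) u" for b
    by (rule lipschitz_near_linear_image[OF bounded_linear_vec_nth C1_imp_lipschitz_near[OF W f2(2)]])
  then have "lipschitz_near (\<lambda>x. \<Sum>b\<in>Basis. (frechet_derivative f (at x) (b, 0) $ j) *\<^sub>R b) u"
    by (intro lipschitz_near_intros)
  then show ?thesis
  proof (rule lipschitz_near_cong)
    have "\<forall>\<^sub>F x in nhds u. x \<in> W" using W by (rule eventually_nhds_in_open)
    then show "\<forall>\<^sub>F x in nhds u. (\<Sum>b\<in>Basis. (frechet_derivative f (at x) (b, 0) $ j) *\<^sub>R b) = grad_x f j x"
      by eventually_elim (simp add: grad_x_eq_sum f2(1))
  qed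
qed

lemma orth_proj:
  fixes S :: "'a::euclidean_space set"
  assumes "subspace S"
  shows "orth_proj S v \<in> S" "w \<in> S \<Longrightarrow> orthogonal (v - orth_proj S v) w"
  using theI'[OF orth_proj_ex1[OF assms, of v]] unfolding orth_proj_def by blast+

text \<open>\<open>kuo_N f j u\<close> is orthogonal to the span of the other gradients, so by
  Pythagoras its norm is the distance of the \<open>j\<close>-th gradient from that span.\<close>

lemma kuo_N_le_norm:
  fixes f :: "(real^'n) \<times> (real^'l) \<Rightarrow> real^'p"
  assumes "w \<in> span ((\<lambda>i. grad_x f i u) ` (- {j}))"
  shows "norm (kuo_N f j u) \<le> norm (grad_x f j u + w)"
proof -
  let ?S = "span ((\<lambda>i. grad_x f i u) ` (- {j}))"
  let ?q = "orth_proj ?S (grad_x f j u)"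
  have S: "subspace ?S" by simp
  have "?q + w \<in> ?S" using orth_proj(1)[OF S] assms by (rule span_add)
  then have "orthogonal (kuo_N f j u) (?q + w)"
    unfolding kuo_N_def by (rule orth_proj(2)[OF S])
  then have "(norm (kuo_N f j u + (?q + w)))\<^sup>2 = (norm (kuo_N f j u))\<^sup>2 + (norm (?q + w))\<^sup>2"
    by (rule norm_add_Pythagorean)
  moreover have "kuo_N f j u + (?q + w) = grad_x f j u + w" by (simp add: kuo_N_def)
  ultimately have "(norm (kuo_N f j u))\<^sup>2 \<le> (norm (grad_x f j u + w))\<^sup>2" by simp
  then show ?thesis by (rule power2_le_imp_le) simp
qed

text \<open>Turns the Kuo distance into quantitative linear independence. For the largest
  coefficient \<open>y $ k\<close>, the combination is \<open>y $ k\<close> times the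
  \<open>k\<close>-th gradient plus an element of the span of the others, and \<open>|y|\<close> is
  at most \<open>CARD('p)\<close> times \<open>|y $ k|\<close>.\<close>

lemma kuo_dist_lower_bound:
  fixes f :: "(real^'n) \<times> (real^'l) \<Rightarrow> real^'p" and y :: "real^'p"
  shows "kuo_dist f u * norm y \<le> real CARD('p) * norm (\<Sum>j\<in>UNIV. y $ j *\<^sub>R grad_x f j u)"
proof -
  obtain k where k: "\<And>j. \<bar>y $ j\<bar> \<le> \<bar>y $ k\<bar>"
  proof -
    have "Max (range (\<lambda>j. \<bar>y $ j\<bar>)) \<in> range (\<lambda>j. \<bar>y $ j\<bar>)" by (intro Max_in) auto
    then obtain k where "Max (range (\<lambda>j. \<bar>y $ j\<bar>)) = \<bar>y $ k\<bar>" by (rule imageE)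
    then show ?thesis by (intro that[of k]) (metis Max_ge finite finite_imageI rangeI)
  qed
  have y: "norm y \<le> real CARD('p) * \<bar>y $ k\<bar>"
    using norm_le_l1_cart[of y] sum_mono[of UNIV "\<lambda>j. \<bar>y $ j\<bar>" "\<lambda>_. \<bar>y $ k\<bar>"] k
    by (auto intro: order_trans)
  have N: "kuo_dist f u \<le> norm (kuo_N f k u)"
    unfolding kuo_dist_def by (rule Min_le) auto
  have pos: "0 \<le> kuo_dist f u" unfolding kuo_dist_def by (subst Min_ge_iff) auto
  have main: "\<bar>y $ k\<bar> * norm (kuo_N f k u) \<le> norm (\<Sum>j\<in>UNIV. y $ j *\<^sub>R grad_x f j u)"
  proof (cases "y $ k = 0")
    case False
    define w where "w = (1 / y $ k) *\<^sub>R (\<Sum>j\<in>- {k}. y $ j *\<^sub>R grad_x f j u)"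
    have "w \<in> span ((\<lambda>i. grad_x f i u) ` (- {k}))"
      unfolding w_def by (intro span_scale span_sum) (auto intro: span_base)
    then have "norm (kuo_N f k u) \<le> norm (grad_x f k u + w)" by (rule kuo_N_le_norm)
    then have "\<bar>y $ k\<bar> * norm (kuo_N f k u) \<le> norm (y $ k *\<^sub>R (grad_x f k u + w))"
      unfolding norm_scaleR by (rule mult_left_mono) simp
    also have "y $ k *\<^sub>R (grad_x f k u + w) = (\<Sum>j\<in>UNIV. y $ j *\<^sub>R grad_x f j u)"
      using False unfolding w_def
      by (subst sum.remove[of UNIV k]) (auto simp: scaleR_add_right Compl_eq_Diff_UNIV)
    finally show ?thesis .
  qed simp
  have "kuo_dist f u * norm y \<le> kuo_dist f u * (real CARD('p) * \<bar>y $ k\<bar>)"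
    by (rule mult_left_mono[OF y pos])
  also have "\<dots> \<le> norm (kuo_N f k u) * (real CARD('p) * \<bar>y $ k\<bar>)"
    by (rule mult_right_mono[OF N]) simp
  also have "\<dots> = real CARD('p) * (\<bar>y $ k\<bar> * norm (kuo_N f k u))" by simp
  also have "\<dots> \<le> real CARD('p) * norm (\<Sum>j\<in>UNIV. y $ j *\<^sub>R grad_x f j u)"
    by (rule mult_left_mono[OF main]) simp
  finally show ?thesis .
qed

section \<open>The Kuo vector field\<close>

text \<open>Of the smallness conditions, the first keeps \<open>h\<close> and the drift of
  \<open>F\<close> small against the horn, the second makes the change of the gradients cost at most
  half of the Kuo bound, and the third makes the field at most \<open>\<rho> / 4\<close>.\<close>

locale flat_deformation =
  fixes S :: "(real^'n) set" and f g :: "(real^'n) \<times> (real^'l) \<Rightarrow> real^'p"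
    and r :: nat and W :: "((real^'n) \<times> (real^'l)) set" and \<alpha> K w c :: real
  assumes S: "closed S" "0 \<in> S"
    and W: "open W" "cball 0 \<alpha> \<subseteq> W"
    and smooth: "Ck_on 2 f W" "Ck_on 2 g W"
    and pos: "0 < \<alpha>" "0 \<le> K" "0 < w" "0 < c"
    and flat: "norm u \<le> \<alpha> \<Longrightarrow> norm (g u - f u) \<le> K * infdist (fst u) S ^ (r + 2)"
    and grad_flat: "norm u \<le> \<alpha> \<Longrightarrow> 0 < infdist (fst u) S \<Longrightarrow>
      norm (grad_x g j u - grad_x f j u) \<le> K * infdist (fst u) S ^ (r + 1)"
    and kuo: "norm u \<le> \<alpha> \<Longrightarrow> 0 < infdist (fst u) S \<Longrightarrow> norm (f u) \<le> w * infdist (fst u) S ^ r \<Longrightarrow>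
      c * infdist (fst u) S ^ r \<le> kuo_dist f u"
    and small: "2 ^ (r + 2) * K * \<alpha>\<^sup>2 \<le> w / 2 ^ (r + 3)"
      "2 * (real CARD('p))\<^sup>2 * K * \<alpha> \<le> c"
      "16 * real CARD('p) * K * \<alpha> \<le> c"
begin

definition d :: "(real^'n) \<times> (real^'l) \<Rightarrow> real" where
  "d u = infdist (fst u) S"

text \<open>The term \<open>\<alpha> - norm u\<close> makes the field vanish outside the ball of
  radius \<open>\<alpha>\<close>, beyond which no hypothesis on \<open>f\<close> and
  \<open>g\<close> is available.\<close>

definition \<rho> :: "(real^'n) \<times> (real^'l) \<Rightarrow> real" where
  "\<rho> u = min (d u) (max 0 (\<alpha> - norm u))"

definition h :: "(real^'n) \<times> (real^'l) \<Rightarrow> real^'p" where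
  "h u = g u - f u"

definition F :: "real \<Rightarrow> (real^'n) \<times> (real^'l) \<Rightarrow> real^'p" where
  "F t u = f u + t *\<^sub>R h u"

text \<open>These are the gradients in \<open>x\<close> of the components of \<open>F t\<close>,
  written so that the flatness of the difference of gradients applies directly.\<close>

definition gr :: "real \<Rightarrow> (real^'n) \<times> (real^'l) \<Rightarrow> 'p \<Rightarrow> real^'n" where
  "gr t u j = grad_x f j u + t *\<^sub>R (grad_x g j u - grad_x f j u)"

definition V :: "real \<Rightarrow> (real^'n) \<times> (real^'l) \<Rightarrow> real^'n" where
  "V t u = least_solution (gr t u) (h u)"

text \<open>Where \<open>d u > 0\<close>, the first factor is 1 for \<open>norm (F t u)\<close> up
  to \<open>w / 4 * d u ^ r\<close> and 0 from \<open>w / 2 * d u ^ r\<close> on; the second falls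
  from 1 at \<open>norm u = \<alpha> / 2\<close> to 0 at \<open>\<alpha>\<close>. As
  \<open>V\<close> is controlled up to \<open>3 / 4 * w * d u ^ r\<close>, the cut-off vanishes
  before control is lost.\<close>

definition cut :: "real \<Rightarrow> (real^'n) \<times> (real^'l) \<Rightarrow> real" where
  "cut t u = min 1 (max 0 (2 - 4 * norm (F t u) / (w * d u ^ r))) * min 1 (max 0 (2 - 2 * norm u / \<alpha>))"

text \<open>
  Where \<open>\<rho> u = 0\<close>, the quotient in \<open>cut\<close> and the field \<open>V\<close> have junk values; this happens on
  \<open>S\<close> and outside the ball of radius \<open>\<alpha>\<close>, where the field must vanish.
\<close>

definition Y :: "real \<Rightarrow> (real^'n) \<times> (real^'l) \<Rightarrow> (real^'n) \<times> (real^'l)" where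
  "Y t u = (if 0 < \<rho> u then - cut t u *\<^sub>R (V t u, 0) else 0)"

section \<open>Distance estimates and the size of the field\<close>

lemma d_nonneg: "0 \<le> d u" by (simp add: d_def infdist_nonneg)

lemma norm_fst_diff_le: "norm (fst u - fst v) \<le> norm (u - v)"
  by (metis fst_diff norm_fst_le prod.collapse)

lemma d_lipschitz: "\<bar>d u - d v\<bar> \<le> norm (u - v)"
  using infdist_triangle_abs[of "fst u" S "fst v"] norm_fst_diff_le[of u v]
  by (simp add: d_def dist_norm)

lemma d_le_norm: "d u \<le> norm u"
  using d_lipschitz[of u 0] S(2) by (simp add: d_def)

lemma \<rho>_lipschitz: "\<bar>\<rho> u - \<rho> v\<bar> \<le> norm (u - v)"
  using d_lipschitz[of u v] norm_triangle_ineq3[of u v] unfolding \<rho>_def by linarith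

lemma \<rho>_pos_iff: "0 < \<rho> u \<longleftrightarrow> 0 < d u \<and> norm u < \<alpha>"
  by (auto simp: \<rho>_def)

lemma flat_h: "norm u \<le> \<alpha> \<Longrightarrow> norm (h u) \<le> K * d u ^ (r + 2)"
  using flat by (simp add: h_def d_def)

lemma flat_h_horn:
  assumes "norm u \<le> \<alpha>"
  shows "norm (h u) \<le> w / 4 * d u ^ r"
proof -
  have "norm (h u) \<le> K * (d u)\<^sup>2 * d u ^ r"
    using flat_h[OF assms] by (simp add: power_add power2_eq_square mult_ac)
  also have "\<dots> \<le> K * \<alpha>\<^sup>2 * d u ^ r"
    using assms d_le_norm[of u] d_nonneg[of u] pos
    by (intro mult_right_mono mult_left_mono power_mono) auto
  also have "K * \<alpha>\<^sup>2 \<le> w / 4"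
  proof -
    have "1 * (K * \<alpha>\<^sup>2) \<le> 2 ^ (r + 2) * (K * \<alpha>\<^sup>2)"
      using pos by (intro mult_right_mono one_le_power) auto
    moreover have "w / 2 ^ (r + 3) \<le> w / 2 ^ 2"
      using pos by (intro divide_left_mono power_increasing) auto
    moreover have "w / 2 ^ 2 = w / 4" by simp
    ultimately show ?thesis using small(1) by (simp only: mult.assoc)
  qed
  then have "K * \<alpha>\<^sup>2 * d u ^ r \<le> w / 4 * d u ^ r"
    using d_nonneg by (intro mult_right_mono) auto
  finally show ?thesis .
qed

text \<open>The horn of width \<open>3 / 4 * w\<close> for \<open>F t\<close> lies in that of width
  \<open>w\<close> for \<open>f\<close>, because \<open>h\<close> takes at most
  \<open>w / 4\<close>. There the Kuo bound holds for \<open>f\<close>, and the gradients of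
  \<open>F t\<close> differ by \<open>O(d^(r+1))\<close>, which on a small ball costs half of
  it.\<close>

lemma gr_lower_bound:
  assumes t: "t \<in> {0..1}" and u: "norm u \<le> \<alpha>" "0 < d u" and F: "norm (F t u) \<le> 3 / 4 * w * d u ^ r"
  shows "c / (2 * real CARD('p)) * d u ^ r * norm y \<le> norm (\<Sum>j\<in>UNIV. y $ j *\<^sub>R gr t u j)"
proof -
  let ?p = "real CARD('p)"
  have "norm (f u) \<le> norm (F t u) + norm (t *\<^sub>R h u)"
    using norm_triangle_ineq4[of "F t u" "t *\<^sub>R h u"] by (simp add: F_def)
  also have "norm (t *\<^sub>R h u) \<le> norm (h u)"
    using t by (auto intro: mult_left_le_one_le)
  finally have "norm (f u) \<le> w * infdist (fst u) S ^ r"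
    using F flat_h_horn[OF u(1)] by (simp add: d_def)
  then have "c * d u ^ r \<le> kuo_dist f u"
    using kuo u by (simp add: d_def)
  then have "c * d u ^ r * norm y \<le> kuo_dist f u * norm y" by (rule mult_right_mono) simp
  also note kuo_dist_lower_bound
  finally have 1: "c / ?p * d u ^ r * norm y \<le> norm (\<Sum>j\<in>UNIV. y $ j *\<^sub>R grad_x f j u)"
    by (simp add: field_simps)
  have "norm (\<Sum>j\<in>UNIV. y $ j *\<^sub>R t *\<^sub>R (grad_x g j u - grad_x f j u)) \<le> (\<Sum>j\<in>(UNIV::'p set). norm y * (K * d u ^ (r + 1)))"
  proof (rule sum_norm_le)
    fix j :: 'p
    have "\<bar>t\<bar> * norm (grad_x g j u - grad_x f j u) \<le> 1 * (K * d u ^ (r + 1))"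
      using t grad_flat[of u j] u by (intro mult_mono) (auto simp: d_def)
    then show "norm (y $ j *\<^sub>R t *\<^sub>R (grad_x g j u - grad_x f j u)) \<le> norm y * (K * d u ^ (r + 1))"
      unfolding norm_scaleR real_norm_def
      by (intro mult_mono[of "\<bar>y $ j\<bar>"] component_le_norm_cart) auto
  qed
  also have "\<dots> = (?p * K * d u) * (d u ^ r * norm y)" by (simp add: mult_ac)
  also have "\<dots> \<le> (c / (2 * ?p)) * (d u ^ r * norm y)"
  proof (rule mult_right_mono)
    have "?p * K * d u \<le> ?p * K * \<alpha>"
      using d_le_norm[of u] u pos by (intro mult_left_mono) auto
    also have "\<dots> \<le> c / (2 * ?p)" using small(2) by (simp add: field_simps power2_eq_square)
    finally show "?p * K * d u \<le> c / (2 * ?p)" .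
  qed (use u in auto)
  finally have 2: "norm (\<Sum>j\<in>UNIV. y $ j *\<^sub>R t *\<^sub>R (grad_x g j u - grad_x f j u))
      \<le> c / (2 * ?p) * d u ^ r * norm y" by simp
  have sum: "(\<Sum>j\<in>UNIV. y $ j *\<^sub>R gr t u j) = (\<Sum>j\<in>UNIV. y $ j *\<^sub>R grad_x f j u)
      + (\<Sum>j\<in>UNIV. y $ j *\<^sub>R t *\<^sub>R (grad_x g j u - grad_x f j u))"
    by (simp add: gr_def scaleR_add_right sum.distrib)
  have "c / ?p * d u ^ r * norm y = c / (2 * ?p) * d u ^ r * norm y + c / (2 * ?p) * d u ^ r * norm y"
    by (simp add: field_simps)
  moreover have "X \<le> e" if "Y = X + X" "Y \<le> a" "b \<le> X" "a - b \<le> e" for X Y a b e :: real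
    using that by linarith
  ultimately show ?thesis unfolding sum using 1 2 norm_diff_ineq by blast
qed

lemma
  assumes t: "t \<in> {0..1}" and u: "norm u \<le> \<alpha>" "0 < d u" and F: "norm (F t u) \<le> 3 / 4 * w * d u ^ r"
  shows det_gram_gr: "det (gram (gr t u)) \<noteq> 0"
    and V_inner: "gr t u j \<bullet> V t u = h u $ j"
    and V_bound: "norm (V t u) \<le> (d u)\<^sup>2 / (8 * \<alpha>)"
proof -
  let ?p = "real CARD('p)"
  let ?m = "c / (2 * ?p) * d u ^ r"
  have m: "0 < ?m" using pos u by simp
  note lb = gr_lower_bound[OF assms]
  show "det (gram (gr t u)) \<noteq> 0" by (rule det_gram_nonzero[OF m lb])
  show "gr t u j \<bullet> V t u = h u $ j" unfolding V_def by (rule least_solution_inner[OF m lb])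
  have "norm (V t u) \<le> norm (h u) / ?m" unfolding V_def by (rule least_solution_bound[OF m lb])
  also have "\<dots> \<le> (K * d u ^ (r + 2)) / ?m"
    using flat_h[OF u(1)] m by (intro divide_right_mono) auto
  also have "\<dots> = (2 * ?p * K / c) * (d u)\<^sup>2"
    using u pos by (simp add: power_add power2_eq_square field_simps)
  also have "\<dots> \<le> (1 / (8 * \<alpha>)) * (d u)\<^sup>2"
    using small(3) pos by (intro mult_right_mono) (auto simp: field_simps)
  finally show "norm (V t u) \<le> (d u)\<^sup>2 / (8 * \<alpha>)" by simp
qed

lemma cut_bounds: "0 \<le> cut t u" "cut t u \<le> 1"
  unfolding cut_def by (auto intro: mult_le_one)

lemma cut_outside:
  assumes "0 < d u" "w / 2 * d u ^ r \<le> norm (F t u)"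
  shows "cut t u = 0"
proof -
  have "2 \<le> 4 * norm (F t u) / (w * d u ^ r)"
    using assms pos by (simp add: field_simps)
  then show ?thesis by (simp add: cut_def)
qed

lemma cut_inside:
  assumes "norm (F t u) \<le> w / 4 * d u ^ r" "norm u \<le> \<alpha> / 2"
  shows "cut t u = 1"
proof -
  have "4 * norm (F t u) / (w * d u ^ r) \<le> 1"
    using assms(1) pos d_nonneg[of u] by (intro divide_le_eq_1[THEN iffD2]) (auto simp: zero_less_mult_iff)
  moreover have "2 * norm u / \<alpha> \<le> 1" using assms(2) pos by (simp add: field_simps)
  ultimately show ?thesis by (simp add: cut_def)
qed

text \<open>The two parts of \<open>\<rho>\<close> are met separately:
  \<open>(d u)^2 / (8 \<alpha>) \<le> d u / 4\<close> because \<open>d u \<le> \<alpha>\<close>, and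
  the second factor of \<open>cut\<close> supplies the decay in
  \<open>\<alpha> - norm u\<close>.\<close>

lemma cut_V_bound:
  assumes t: "t \<in> {0..1}" and "0 < \<rho> u"
  shows "norm (cut t u *\<^sub>R V t u) \<le> \<rho> u / 4"
proof (cases "norm (F t u) \<le> 3 / 4 * w * d u ^ r")
  case False
  have u: "0 < d u" "norm u < \<alpha>" using assms \<rho>_pos_iff by auto
  have "w / 2 * d u ^ r \<le> 3 / 4 * w * d u ^ r" using u pos by (intro mult_right_mono) auto
  then have "cut t u = 0" using False by (intro cut_outside u) linarith
  then show ?thesis using assms by simp
next
  case True
  have u: "0 < d u" "norm u < \<alpha>" using assms \<rho>_pos_iff by auto
  have V: "norm (V t u) \<le> (d u)\<^sup>2 / (8 * \<alpha>)" using True u by (intro V_bound t) auto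
  have d\<alpha>: "d u \<le> \<alpha>" using d_le_norm[of u] u by simp
  have "norm (cut t u *\<^sub>R V t u) \<le> 1 * ((d u)\<^sup>2 / (8 * \<alpha>))"
    unfolding norm_scaleR using cut_bounds[of t u] V by (intro mult_mono) auto
  also have "\<dots> = d u * d u / (8 * \<alpha>)" by (simp add: power2_eq_square)
  also have "\<dots> \<le> d u * \<alpha> / (8 * \<alpha>)"
    using u d\<alpha> pos by (intro divide_right_mono mult_left_mono) auto
  also have "\<dots> \<le> d u / 4" using pos u by (simp add: field_simps)
  finally have 1: "norm (cut t u *\<^sub>R V t u) \<le> d u / 4" .
  have "cut t u \<le> 1 * (2 - 2 * norm u / \<alpha>)"
    unfolding cut_def using u pos by (intro mult_mono) (auto simp: field_simps)
  then have "norm (cut t u *\<^sub>R V t u) \<le> (2 - 2 * norm u / \<alpha>) * ((d u)\<^sup>2 / (8 * \<alpha>))"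
    unfolding norm_scaleR using cut_bounds[of t u] V by (intro mult_mono) auto
  also have "\<dots> \<le> (2 - 2 * norm u / \<alpha>) * (\<alpha>\<^sup>2 / (8 * \<alpha>))"
    using u pos d\<alpha> by (intro mult_left_mono divide_right_mono power_mono) (auto simp: field_simps)
  also have "\<dots> = (\<alpha> - norm u) / 4" using pos by (simp add: field_simps power2_eq_square)
  finally have 2: "norm (cut t u *\<^sub>R V t u) \<le> (\<alpha> - norm u) / 4" .
  show ?thesis using 1 2 by (simp add: \<rho>_def)
qed

lemma Y_bound: "t \<in> {0..1} \<Longrightarrow> norm (Y t u) \<le> \<rho> u / 4"
  using cut_V_bound[of t u] by (auto simp: Y_def \<rho>_def norm_Pair d_nonneg)

section \<open>Regularity of the field\<close>

lemma lipschitz_near_parts: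
  assumes "norm u < \<alpha>"
  shows "lipschitz_near (\<lambda>tu. f (snd tu)) (t, u)" "lipschitz_near (\<lambda>tu. h (snd tu)) (t, u)"
    and "lipschitz_near (\<lambda>tu. gr (fst tu) (snd tu) j) (t, u)"
    and "lipschitz_near (\<lambda>tu. F (fst tu) (snd tu)) (t, u)"
    and "lipschitz_near (\<lambda>tu. d (snd tu)) (t, u)"
    and "lipschitz_near (\<lambda>tu. norm (snd tu)) (t, u)"
proof -
  have uW: "u \<in> W" using assms W by auto
  have C1: "Ck_on (Suc 0) f W" "Ck_on (Suc 0) g W" using smooth Ck_on_le[of 2 _ W "Suc 0"] by auto
  have fst: "lipschitz_near fst (t, u)" and snd: "lipschitz_near snd (t, u)"
    by (intro lipschitz_near_bounded_linear bounded_linear_fst bounded_linear_snd)+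
  have comp: "lipschitz_near (\<lambda>tu. k (snd tu)) (t, u)" if "lipschitz_near k u" for k :: "_ \<Rightarrow> 'x::metric_space"
    by (rule lipschitz_near_compose[OF snd]) (use that in simp)
  show f: "lipschitz_near (\<lambda>tu. f (snd tu)) (t, u)"
    by (intro comp C1_imp_lipschitz_near[OF W(1) uW] C1)
  show h: "lipschitz_near (\<lambda>tu. h (snd tu)) (t, u)"
    unfolding h_def by (intro comp lipschitz_near_diff C1_imp_lipschitz_near[OF W(1) uW] C1)
  show "lipschitz_near (\<lambda>tu. gr (fst tu) (snd tu) j) (t, u)"
    unfolding gr_def
    by (intro lipschitz_near_add lipschitz_near_scaleR fst lipschitz_near_diff
        comp[OF lipschitz_near_grad_x[OF W(1) uW]] smooth)
  show "lipschitz_near (\<lambda>tu. F (fst tu) (snd tu)) (t, u)"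
    unfolding F_def by (intro lipschitz_near_add lipschitz_near_scaleR fst f h)
  show "lipschitz_near (\<lambda>tu. d (snd tu)) (t, u)"
    unfolding d_def
    by (intro comp lipschitz_near_infdist lipschitz_near_bounded_linear bounded_linear_fst)
  show "lipschitz_near (\<lambda>tu. norm (snd tu)) (t, u)"
    by (intro lipschitz_near_norm snd)
qed

text \<open>At a point of the horn of width \<open>3 / 4 * w\<close> the Gram determinant is nonzero
  and the explicit formula applies. At any other point \<open>norm (F t u)\<close> exceeds
  \<open>w / 2 * d u ^ r\<close>; this persists nearby, so \<open>Y\<close> is locally zero.\<close>

lemma lipschitz_near_Y:
  assumes t: "t \<in> {0..1}" and \<rho>: "0 < \<rho> u"
  shows "lipschitz_near (\<lambda>tu. Y (fst tu) (snd tu)) (t, u)"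
proof -
  have u: "0 < d u" "norm u < \<alpha>" using \<rho> \<rho>_pos_iff by auto
  note parts = lipschitz_near_parts[OF u(2), where t = t]
  have "\<forall>\<^sub>F tu in nhds (t, u). 0 < d (snd tu)" "\<forall>\<^sub>F tu in nhds (t, u). norm (snd tu) < \<alpha>"
    using lipschitz_near_imp_tendsto[OF parts(5)] lipschitz_near_imp_tendsto[OF parts(6)] u
    by (auto intro: order_tendstoD)
  then have near: "\<forall>\<^sub>F tu in nhds (t, u). 0 < \<rho> (snd tu)"
    by eventually_elim (simp add: \<rho>_pos_iff)
  show ?thesis
  proof (cases "norm (F t u) \<le> 3 / 4 * w * d u ^ r")
    case True
    have V: "lipschitz_near (\<lambda>tu. V (fst tu) (snd tu)) (t, u)"
      unfolding V_def
    proof (rule lipschitz_near_least_solution)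
      show "lipschitz_near (\<lambda>tu. h (snd tu) $ i) (t, u)" for i
        by (rule lipschitz_near_linear_image[OF bounded_linear_vec_nth parts(2)])
      show "det (gram (gr (fst (t, u)) (snd (t, u)))) \<noteq> 0"
        using det_gram_gr[OF t _ u(1) True] u by simp
    qed (rule parts)
    have cut: "lipschitz_near (\<lambda>tu. cut (fst tu) (snd tu)) (t, u)"
      unfolding cut_def
      by (intro lipschitz_near_mult lipschitz_near_clamp lipschitz_near_diff lipschitz_near_const
          lipschitz_near_divide lipschitz_near_norm lipschitz_near_power parts) (use pos u in auto)
    have "bounded_linear (\<lambda>v::real^'n. (v, 0::real^'l))"
      by (intro bounded_linear_Pair bounded_linear_ident bounded_linear_zero)
    then have "lipschitz_near (\<lambda>tu. - cut (fst tu) (snd tu) *\<^sub>R (V (fst tu) (snd tu), 0::real^'l)) (t, u)"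
      by (intro lipschitz_near_scaleR lipschitz_near_minus cut lipschitz_near_linear_image[OF _ V])
    then show ?thesis
    proof (rule lipschitz_near_cong)
      show "\<forall>\<^sub>F tu in nhds (t, u). - cut (fst tu) (snd tu) *\<^sub>R (V (fst tu) (snd tu), 0) = Y (fst tu) (snd tu)"
        using near by eventually_elim (simp add: Y_def)
    qed
  next
    case False
    have diff: "lipschitz_near (\<lambda>tu. norm (F (fst tu) (snd tu)) - w / 2 * d (snd tu) ^ r) (t, u)"
      by (intro lipschitz_near_diff lipschitz_near_norm lipschitz_near_mult
          lipschitz_near_const lipschitz_near_power parts)
    have "0 < norm (F t u) - w / 2 * d u ^ r"
    proof -
      have "w / 2 * d u ^ r \<le> 3 / 4 * w * d u ^ r" using u pos by (intro mult_right_mono) auto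
      then show ?thesis using False by linarith
    qed
    then have "\<forall>\<^sub>F tu in nhds (t, u). 0 < norm (F (fst tu) (snd tu)) - w / 2 * d (snd tu) ^ r"
      using order_tendstoD(1)[OF lipschitz_near_imp_tendsto[OF diff], of 0] by simp
    then have "\<forall>\<^sub>F tu in nhds (t, u). 0 = Y (fst tu) (snd tu)"
      using near by eventually_elim (simp add: Y_def cut_outside \<rho>_pos_iff flip: zero_prod_def)
    then show ?thesis by (rule lipschitz_near_cong[OF lipschitz_near_const])
  qed
qed

sublocale field: controlled_field Y \<rho>
proof
  show "0 \<le> \<rho> u" for u using d_nonneg by (simp add: \<rho>_def)
  show "\<bar>\<rho> u - \<rho> v\<bar> \<le> norm (u - v)" for u v by (rule \<rho>_lipschitz)
  show "norm (Y t u) \<le> \<rho> u / 4" if "t \<in> {0..1}" for t u by (rule Y_bound[OF that])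
  have "continuous_on ({0..1} \<times> {u. 0 < \<rho> u}) (\<lambda>tu. Y (fst tu) (snd tu))"
    by (intro continuous_at_imp_continuous_on ballI lipschitz_near_imp_continuous)
      (auto intro: lipschitz_near_Y)
  then show "continuous_on ({0..1} \<times> {u. 0 < \<rho> u}) (\<lambda>(t, u). Y t u)"
    by (simp add: case_prod_unfold)
  fix u assume u: "0 < \<rho> u"
  have \<rho>_near: "0 < \<rho> v" if "v \<in> cball u (\<rho> u / 2)" for v
    using \<rho>_lipschitz[of u v] that u by (simp add: dist_norm)
  \<comment> \<open>Compactness is used in \<open>t\<close> and \<open>u\<close> jointly, so that
    one constant serves all times.\<close>
  have "\<exists>L. L-lipschitz_on ({0..1} \<times> cball u (\<rho> u / 2)) (\<lambda>tu. Y (fst tu) (snd tu))"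
    by (rule lipschitz_near_imp_lipschitz_on_compact)
      (auto intro!: compact_Times lipschitz_near_Y \<rho>_near)
  then obtain L where L: "L-lipschitz_on ({0..1} \<times> cball u (\<rho> u / 2)) (\<lambda>tu. Y (fst tu) (snd tu))"
    by blast
  have "L-lipschitz_on (cball u (\<rho> u / 2)) (Y t)" if t: "t \<in> {0..1}" for t
  proof (rule lipschitz_onI)
    fix v v' assume v: "v \<in> cball u (\<rho> u / 2)" "v' \<in> cball u (\<rho> u / 2)"
    have "dist (Y (fst (t, v)) (snd (t, v))) (Y (fst (t, v')) (snd (t, v'))) \<le> L * dist (t, v) (t, v')"
      by (rule lipschitz_onD[OF L]) (use t v in auto)
    then show "dist (Y t v) (Y t v') \<le> L * dist v v'" by (simp add: dist_Pair_Pair)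
  qed (rule lipschitz_on_nonneg[OF L])
  then show "\<exists>L. \<forall>t\<in>{0..1}. L-lipschitz_on (cball u (\<rho> u / 2)) (Y t)" by blast
qed

section \<open>The deformation along solutions\<close>

lemma solution_snd:
  assumes z: "solves_ode Y z u"
  shows "snd (z 1) = snd u"
proof -
  have "norm (snd (z 1) - snd (z 0)) \<le> 0 * \<bar>1 - 0\<bar>"
  proof (rule vector_derivative_bound_interval)
    fix t :: real assume t: "t \<in> {0..1}"
    show "((\<lambda>t. snd (z t)) has_vector_derivative snd (Y t (z t))) (at t within {0..1})"
      by (rule bounded_linear.has_vector_derivative[OF bounded_linear_snd])
        (use z t in \<open>auto simp: solves_ode_def\<close>)
    show "norm (snd (Y t (z t))) \<le> 0" by (simp add: Y_def)
  qed auto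
  then show ?thesis using z by (simp add: solves_ode_def)
qed

text \<open>All three bounds come from the displacement \<open>d u / 3\<close>. A start within
  \<open>\<alpha> / 4\<close> keeps the solution where the second factor of \<open>cut\<close> is
  1.\<close>

lemma solution_near:
  assumes z: "solves_ode Y z u" and u: "norm u < \<alpha> / 4" "0 < d u" and t: "t \<in> {0..1}"
  shows "norm (z t) \<le> \<alpha> / 2" "d u / 2 \<le> d (z t)" "d (z t) \<le> 2 * d u"
proof -
  have disp: "norm (z t - u) \<le> d u / 3"
    using field.solution_displacement[OF z t] by (simp add: \<rho>_def min_le_iff_disj)
  show "norm (z t) \<le> \<alpha> / 2"
    using norm_triangle_ineq2[of "z t" u] disp d_le_norm[of u] u by linarith
  show "d u / 2 \<le> d (z t)" "d (z t) \<le> 2 * d u"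
    using d_lipschitz[of "z t" u] disp u by linarith+
qed

text \<open>The derivative is \<open>h\<close> plus \<open>D F\<close> applied to the velocity,
  which is \<open>- cut * h\<close> by the choice of \<open>V\<close>. That identity needs the horn,
  and outside it \<open>cut\<close> is 0.\<close>

lemma F_along_solution:
  assumes z: "solves_ode Y z u" and u: "norm u < \<alpha> / 4" "0 < d u" and t: "t \<in> {0..1}"
  shows "((\<lambda>t. F t (z t)) has_vector_derivative (1 - cut t (z t)) *\<^sub>R h (z t)) (at t within {0..1})"
proof -
  note near = solution_near[OF z u t]
  have zt: "norm (z t) < \<alpha>" "0 < d (z t)" "0 < \<rho> (z t)"
    using near u pos by (auto simp: \<rho>_pos_iff)
  have W: "z t \<in> W" using zt W by auto
  have df: "f differentiable (at (z t))" and dg: "g differentiable (at (z t))"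
    using smooth W by (auto simp: numeral_2_eq_2)
  let ?v = "- cut t (z t) *\<^sub>R (V t (z t), 0::real^'l)"
  have Yv: "Y t (z t) = ?v" using zt by (simp add: Y_def)
  have zd: "(z has_vector_derivative ?v) (at t within {0..1})"
    using z t unfolding solves_ode_def Yv[symmetric] by blast
  let ?Df = "frechet_derivative f (at (z t))" and ?Dg = "frechet_derivative g (at (z t))"
  have chain: "((\<lambda>t. k (z t)) has_vector_derivative frechet_derivative k (at (z t)) ?v) (at t within {0..1})"
    if "k differentiable (at (z t))" for k :: "_ \<Rightarrow> real^'p"
  proof -
    have "(k has_derivative frechet_derivative k (at (z t))) (at (z t) within z ` {0..1})"
      using that unfolding frechet_derivative_works by (rule has_derivative_at_withinI)
    then show ?thesis using vector_derivative_diff_chain_within[OF zd] by (simp add: comp_def)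
  qed
  have lin: "linear ?Df" "linear ?Dg" by (rule linear_frechet_derivative df dg)+
  have "((\<lambda>t. f (z t) + t *\<^sub>R (g (z t) - f (z t))) has_vector_derivative
      ?Df ?v + (t *\<^sub>R (?Dg ?v - ?Df ?v) + 1 *\<^sub>R (g (z t) - f (z t)))) (at t within {0..1})"
    by (intro has_vector_derivative_add has_vector_derivative_scaleR has_vector_derivative_diff
        chain df dg DERIV_ident)
  moreover have "?Df ?v + (t *\<^sub>R (?Dg ?v - ?Df ?v) + 1 *\<^sub>R (g (z t) - f (z t))) = (1 - cut t (z t)) *\<^sub>R h (z t)"
  proof (cases "cut t (z t) = 0")
    case True
    then show ?thesis using linear_0[OF lin(1)] linear_0[OF lin(2)] by (simp add: h_def flip: zero_prod_def)
  next
    case False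
    have F: "norm (F t (z t)) \<le> 3 / 4 * w * d (z t) ^ r"
    proof (rule ccontr)
      assume "\<not> ?thesis"
      moreover have "w / 2 * d (z t) ^ r \<le> 3 / 4 * w * d (z t) ^ r"
        using zt pos by (intro mult_right_mono) auto
      ultimately show False using False cut_outside[OF zt(2), of t] by linarith
    qed
    have "(?Df ?v + t *\<^sub>R (?Dg ?v - ?Df ?v)) $ j = - cut t (z t) * h (z t) $ j" for j
    proof -
      have "(?Df ?v + t *\<^sub>R (?Dg ?v - ?Df ?v)) $ j
          = - cut t (z t) * (?Df (V t (z t), 0) $ j + t * (?Dg (V t (z t), 0) $ j - ?Df (V t (z t), 0) $ j))"
        unfolding linear_cmul[OF lin(1)] linear_cmul[OF lin(2)] by (simp add: algebra_simps)
      also have "?Df (V t (z t), 0) $ j + t * (?Dg (V t (z t), 0) $ j - ?Df (V t (z t), 0) $ j)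
          = gr t (z t) j \<bullet> V t (z t)"
        unfolding grad_x_inner[OF df, symmetric] grad_x_inner[OF dg, symmetric] gr_def
        by (simp add: inner_commute inner_add_right inner_diff_right)
      also have "\<dots> = h (z t) $ j" using V_inner[OF t _ zt(2) F] zt by simp
      finally show ?thesis .
    qed
    then have "?Df ?v + t *\<^sub>R (?Dg ?v - ?Df ?v) = - cut t (z t) *\<^sub>R h (z t)"
      by (simp add: vec_eq_iff)
    then have "?Df ?v + (t *\<^sub>R (?Dg ?v - ?Df ?v) + 1 *\<^sub>R (g (z t) - f (z t)))
        = - cut t (z t) *\<^sub>R h (z t) + h (z t)" by (simp add: h_def add.assoc[symmetric])
    then show ?thesis by (simp add: scaleR_diff_left)
  qed
  ultimately show ?thesis by (simp add: F_def h_def)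
qed

text \<open>The derivative of \<open>F\<close> along the solution is at most
  \<open>norm (h (z s))\<close>, and \<open>d (z s) \<le> 2 * d u\<close> accounts for the factor
  \<open>2 ^ (r + 2)\<close>.\<close>

lemma F_drift:
  assumes z: "solves_ode Y z u" and u: "norm u < \<alpha> / 4" "0 < d u" and t: "t \<in> {0..1}"
  shows "norm (F t (z t) - f u) \<le> 2 ^ (r + 2) * K * d u ^ (r + 2)"
proof -
  have "norm (F t (z t) - F 0 (z 0)) \<le> 2 ^ (r + 2) * K * d u ^ (r + 2) * \<bar>t - 0\<bar>"
  proof (rule vector_derivative_bound_interval[OF F_along_solution[OF z u]])
    fix s :: real assume s: "s \<in> {0..1}"
    note near = solution_near[OF z u s]
    have "norm ((1 - cut s (z s)) *\<^sub>R h (z s)) \<le> 1 * norm (h (z s))"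
      unfolding norm_scaleR using cut_bounds[of s "z s"] by (intro mult_right_mono) auto
    also have "\<dots> \<le> K * d (z s) ^ (r + 2)" using flat_h[of "z s"] near pos by simp
    also have "\<dots> \<le> K * (2 * d u) ^ (r + 2)"
      using near u pos by (intro mult_left_mono power_mono) auto
    finally show "norm ((1 - cut s (z s)) *\<^sub>R h (z s)) \<le> 2 ^ (r + 2) * K * d u ^ (r + 2)"
      by (simp add: power_mult_distrib mult_ac)
  qed (use t in auto)
  also have "\<dots> \<le> 2 ^ (r + 2) * K * d u ^ (r + 2)"
    using t pos u by (intro mult_left_le) auto
  finally show ?thesis using z by (simp add: solves_ode_def F_def)
qed

text \<open>
  The drift bound keeps the solution in the part of the horn where \<open>cut = 1\<close>, so that no
  continuity argument in \<open>t\<close> is needed.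
\<close>

lemma F_constant_in_horn:
  assumes z: "solves_ode Y z u" and u: "norm u < \<alpha> / 4" "0 < d u"
    and horn: "norm (f u) \<le> w / 2 ^ (r + 3) * d u ^ r"
  shows "F 1 (z 1) = f u"
proof -
  have cut: "cut t (z t) = 1" if t: "t \<in> {0..1}" for t
  proof (rule cut_inside)
    note near = solution_near[OF z u t]
    show "norm (z t) \<le> \<alpha> / 2" by (rule near)
    have "norm (F t (z t)) \<le> norm (f u) + norm (F t (z t) - f u)"
      using norm_triangle_ineq[of "f u" "F t (z t) - f u"] by simp
    also have "norm (F t (z t) - f u) \<le> 2 ^ (r + 2) * K * d u ^ (r + 2)" by (rule F_drift[OF z u t])
    also have "\<dots> = 2 ^ (r + 2) * K * (d u)\<^sup>2 * d u ^ r"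
      by (simp add: power_add power2_eq_square mult_ac)
    also have "\<dots> \<le> 2 ^ (r + 2) * K * \<alpha>\<^sup>2 * d u ^ r"
      using u pos d_le_norm[of u] by (intro mult_right_mono mult_left_mono power_mono) auto
    also have "\<dots> \<le> w / 2 ^ (r + 3) * d u ^ r"
      using small(1) u by (intro mult_right_mono) auto
    finally have "norm (F t (z t)) \<le> w / 2 ^ (r + 3) * d u ^ r + w / 2 ^ (r + 3) * d u ^ r"
      using horn by linarith
    \<comment> \<open>Origin of \<open>2 ^ (r + 3)\<close>: the horn and the drift contribute
      equally, and \<open>d\<close> may halve along the solution, which costs
      \<open>2 ^ r\<close>.\<close>
    also have "\<dots> = w / 4 * (d u / 2) ^ r" by (simp add: power_add power_divide field_simps)
    also have "\<dots> \<le> w / 4 * d (z t) ^ r"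
      using near u pos by (intro mult_left_mono power_mono) auto
    finally show "norm (F t (z t)) \<le> w / 4 * d (z t) ^ r" by simp
  qed
  have "norm (F 1 (z 1) - F 0 (z 0)) \<le> 0 * \<bar>1 - 0\<bar>"
    by (rule vector_derivative_bound_interval[OF F_along_solution[OF z u]]) (use cut in auto)
  then show ?thesis using z by (simp add: solves_ode_def F_def)
qed

lemma deformation_trivialised:
  "\<exists>\<phi>. (\<exists>\<psi>. homeomorphism UNIV UNIV \<phi> \<psi>) \<and> (\<forall>u. snd (\<phi> u) = snd u) \<and>
    (\<forall>u. norm (\<phi> u - u) \<le> infdist (fst u) S / 3) \<and>
    (\<forall>u. norm u < \<alpha> / 4 \<longrightarrow>
      norm (g (\<phi> u) - f u) \<le> 2 ^ (r + 2) * K * infdist (fst u) S ^ (r + 2)) \<and>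
    (\<forall>u. norm u < \<alpha> / 4 \<and> norm (f u) \<le> w / 2 ^ (r + 3) * infdist (fst u) S ^ r \<longrightarrow> g (\<phi> u) = f u)"
proof (rule exI[of _ field.time_one], intro conjI allI impI)
  show "\<exists>\<psi>. homeomorphism UNIV UNIV field.time_one \<psi>" by (rule field.time_one_homeomorphism)
  fix u
  obtain z where z: "solves_ode Y z u" using field.solution_exists by blast
  have \<phi>: "field.time_one u = z 1" by (rule field.time_one_eq[OF z])
  show "snd (field.time_one u) = snd u" unfolding \<phi> by (rule solution_snd[OF z])
  show disp: "norm (field.time_one u - u) \<le> infdist (fst u) S / 3"
    using field.time_one_displacement[of u] by (simp add: \<rho>_def d_def min_le_iff_disj)
  have F1: "F 1 v = g v" for v by (simp add: F_def h_def)
  \<comment> \<open>Over \<open>S\<close> the statements along solutions do not apply; there the map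
    fixes \<open>u\<close> and flatness with positive exponent gives
    \<open>g u = f u\<close>.\<close>
  have zero: "g u = f u" if "norm u < \<alpha> / 4" "infdist (fst u) S = 0"
    using flat[of u] that pos by simp
  show "norm (g (field.time_one u) - f u) \<le> 2 ^ (r + 2) * K * infdist (fst u) S ^ (r + 2)"
    if u: "norm u < \<alpha> / 4"
  proof (cases "d u = 0")
    case True
    then show ?thesis using zero[OF u] disp by (simp add: d_def)
  next
    case False
    then show ?thesis using F_drift[OF z u, of 1] d_nonneg[of u] by (simp add: F1 \<phi> d_def)
  qed
  show "g (field.time_one u) = f u"
    if u: "norm u < \<alpha> / 4 \<and> norm (f u) \<le> w / 2 ^ (r + 3) * infdist (fst u) S ^ r"
  proof (cases "d u = 0")
    case True
    then show ?thesis using zero u disp by (simp add: d_def)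
  next
    case False
    then show ?thesis using F_constant_in_horn[OF z, unfolded F1] u d_nonneg[of u]
      by (simp add: \<phi> d_def)
  qed
qed

end

section \<open>Contact equivalence\<close>

lemma rank_one_mult:
  "(mat 1 + (\<chi> i j. e $ i * q $ j / s)) *v x = x + ((q \<bullet> x) / s) *\<^sub>R (e :: real^'p)"
proof -
  have "(\<chi> i j. e $ i * q $ j / s) *v x = ((q \<bullet> x) / s) *\<^sub>R e"
    by (simp add: vec_eq_iff matrix_vector_mult_def inner_vec_def sum_distrib_left sum_divide_distrib mult_ac)
  then show ?thesis by (simp add: matrix_vector_mult_add_rdistrib)
qed

text \<open>
  The matrix \<open>T u\<close> is \<open>1\<close> plus the rank one map sending \<open>q = g (\<phi> u)\<close> to \<open>f u - q\<close>. It is \<open>1\<close> in the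
  horn around the zero set of \<open>f\<close>; outside of it \<open>\<bar>q\<bar>\<close> dominates \<open>d\<^sup>r\<close>, so that the perturbation is
  \<open>O(d\<^sup>2)\<close>.
\<close>

lemma equivalences_of_approximate_conjugation:
  fixes f g :: "(real^'n) \<times> (real^'l) \<Rightarrow> real^'p" and \<phi> :: "(real^'n) \<times> (real^'l) \<Rightarrow> (real^'n) \<times> (real^'l)"
  assumes S: "0 \<in> S" and pos: "0 < \<beta>" "0 \<le> K" "0 < \<kappa>"
    and homeo: "homeomorphism UNIV UNIV \<phi> \<psi>"
    and snd: "\<And>u. snd (\<phi> u) = snd u"
    and fixed: "\<And>u. infdist (fst u) S = 0 \<Longrightarrow> \<phi> u = u"
    and cont: "continuous_on (ball 0 \<beta>) f" "continuous_on (ball 0 \<beta>) (\<lambda>u. g (\<phi> u))"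
    and near: "\<And>u. norm u < \<beta> \<Longrightarrow> norm (g (\<phi> u) - f u) \<le> K * infdist (fst u) S ^ (r + 2)"
    and horn: "\<And>u. norm u < \<beta> \<Longrightarrow> norm (f u) \<le> \<kappa> * infdist (fst u) S ^ r \<Longrightarrow> g (\<phi> u) = f u"
    and small: "4 * K * \<beta>\<^sup>2 \<le> \<kappa>"
  shows "C0_BD_equivalent S f g \<and> C0_contact_equivalent S f g"
proof -
  let ?V = "ball (0 :: (real^'n) \<times> (real^'l)) \<beta>"
  define d where "d = (\<lambda>u::(real^'n) \<times> (real^'l). infdist (fst u) S)"
  define q where "q = (\<lambda>u. g (\<phi> u))"
  define e where "e = (\<lambda>u. f u - q u)"
  define E where "E = (\<lambda>u i j. e u $ i * q u $ j / (q u \<bullet> q u))"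
  define T where "T = (\<lambda>u. mat 1 + (\<chi> i j. E u i j))"
  have d0: "0 \<le> d u" for u by (simp add: d_def infdist_nonneg)
  have d_le: "d u \<le> norm u" for u
  proof -
    have "d u \<le> dist (fst u) 0" unfolding d_def by (rule infdist_le[OF S])
    also have "\<dots> \<le> norm u" using norm_fst_le[of "fst u" "snd u"] by simp
    finally show ?thesis .
  qed
  have d_cont: "isCont d u" for u
    unfolding d_def by (intro continuous_intros)
  have e_bound: "norm (e u) \<le> 2 * K / \<kappa> * (d u)\<^sup>2 * norm (q u)" if u: "norm u < \<beta>" for u
  proof (cases "norm (f u) \<le> \<kappa> * d u ^ r")
    case True
    then have "e u = 0" using horn[OF u] by (simp add: e_def q_def d_def)
    then show ?thesis using pos by simp
  next
    case False
    have "norm (e u) \<le> K * (d u)\<^sup>2 * d u ^ r"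
      using near[OF u] by (simp add: e_def q_def d_def norm_minus_commute power_add power2_eq_square mult_ac)
    moreover have "K * (d u)\<^sup>2 * d u ^ r \<le> \<kappa> / 2 * d u ^ r"
    proof (rule mult_right_mono)
      have "K * (d u)\<^sup>2 \<le> K * \<beta>\<^sup>2"
        using d_le[of u] d0[of u] u pos by (intro mult_left_mono power_mono) auto
      moreover have "0 \<le> K * \<beta>\<^sup>2" using pos by simp
      ultimately show "K * (d u)\<^sup>2 \<le> \<kappa> / 2" using small by simp
    qed (simp add: d0)
    moreover have "norm (f u) \<le> norm (e u) + norm (q u)"
      using norm_triangle_ineq[of "e u" "q u"] by (simp add: e_def)
    ultimately have q: "\<kappa> / 2 * d u ^ r \<le> norm (q u)" using False by (simp add: field_simps)
    have "norm (e u) \<le> K * (d u)\<^sup>2 * d u ^ r" by fact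
    also have "\<dots> = 2 * K / \<kappa> * (d u)\<^sup>2 * (\<kappa> / 2 * d u ^ r)" using pos by simp
    also have "\<dots> \<le> 2 * K / \<kappa> * (d u)\<^sup>2 * norm (q u)"
      using pos by (intro mult_left_mono[OF q]) auto
    finally show ?thesis .
  qed
  \<comment> \<open>The rank one part of \<open>T u\<close> thus has norm at most 1/2, which forces
    the kernel of \<open>T u\<close> to be trivial.\<close>
  have e_half: "norm (e u) \<le> 1 / 2 * norm (q u)" if u: "norm u < \<beta>" for u
  proof -
    have "2 * K / \<kappa> * (d u)\<^sup>2 \<le> 2 * K / \<kappa> * \<beta>\<^sup>2"
      using d_le[of u] d0[of u] u pos by (intro mult_left_mono power_mono) auto
    also have "\<dots> \<le> 1 / 2" using small pos by (simp add: field_simps)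
    finally have "2 * K / \<kappa> * (d u)\<^sup>2 * norm (q u) \<le> 1 / 2 * norm (q u)"
      by (rule mult_right_mono) simp
    then show ?thesis using e_bound[OF u] by linarith
  qed
  have Tmult: "T u *v x = x + ((q u \<bullet> x) / (q u \<bullet> q u)) *\<^sub>R e u" for u x
    unfolding T_def E_def by (rule rank_one_mult)
  have conj: "f u = T u *v g (\<phi> u)" if u: "u \<in> ?V" for u
  proof -
    \<comment> \<open>At \<open>q u = 0\<close> the quotient takes the default value 0, so
      \<open>T u\<close> is the identity; the equation still holds because \<open>e u\<close>
      vanishes too.\<close>
    have "q u = 0 \<Longrightarrow> e u = 0" using e_half[of u] u by simp
    then have "f u = T u *v q u" by (cases "q u = 0") (simp_all add: Tmult, simp_all add: e_def)
    then show ?thesis by (simp add: q_def)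
  qed
  have inv: "invertible (T u)" if u: "u \<in> ?V" for u
  proof -
    have "x = 0" if "T u *v x = 0" for x
    proof -
      have "x = - (((q u \<bullet> x) / (q u \<bullet> q u)) *\<^sub>R e u)"
        using that by (simp add: Tmult eq_neg_iff_add_eq_0)
      then have "norm x = \<bar>q u \<bullet> x\<bar> / (norm (q u))\<^sup>2 * norm (e u)"
        by (metis abs_divide abs_power2 norm_minus_cancel norm_scaleR power2_norm_eq_inner)
      also have "\<dots> \<le> (norm (q u) * norm x) / (norm (q u))\<^sup>2 * (1 / 2 * norm (q u))"
        using u by (intro mult_mono divide_right_mono Cauchy_Schwarz_ineq2 e_half) auto
      also have "\<dots> \<le> 1 / 2 * norm x" by (simp add: power2_eq_square)
      finally show "x = 0" by simp
    qed
    then show ?thesis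
      using matrix_left_invertible_ker[of "T u"] invertible_left_inverse[of "T u"] by blast
  qed
  have zero_iff: "f u = 0 \<longleftrightarrow> g (\<phi> u) = 0" if u: "u \<in> ?V" for u
  proof
    assume "f u = 0"
    then show "g (\<phi> u) = 0" using horn[of u] u pos by (simp add: infdist_nonneg)
  qed (use conj[OF u] in simp)
  have f_cont: "isCont f u" and q_cont: "isCont q u" if "u \<in> ?V" for u
    using cont that unfolding q_def by (auto simp: continuous_on_eq_continuous_at)
  have E_lim: "((\<lambda>v. E v i j) \<longlongrightarrow> E u i j) (at u)" if u: "u \<in> ?V" for u i j
  proof -
    have nearV: "\<forall>\<^sub>F v in at u. v \<in> ?V"
      using eventually_at_in_open'[OF open_ball u] .
    \<comment> \<open>Over \<open>S\<close> the entries are squeezed to 0 by \<open>(d v)^2\<close>.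
      Off \<open>S\<close>, a zero of \<open>q\<close> is a zero of \<open>f\<close>, hence interior
      to the horn, where \<open>e\<close> vanishes identically. Elsewhere the denominator is
      nonzero.\<close>
    consider "d u = 0" | "0 < d u" "q u = 0" | "q u \<noteq> 0" using d0[of u] by fastforce
    then show ?thesis
    proof cases
      case 1
      have E0: "E u i j = 0" using e_bound[of u] u 1 by (simp add: E_def)
      have bound: "norm (E v i j) \<le> 2 * K / \<kappa> * (d v)\<^sup>2" if "v \<in> ?V" for v
      proof (cases "q v = 0")
        case False
        have "norm (E v i j) = \<bar>e v $ i\<bar> * \<bar>q v $ j\<bar> / (norm (q v))\<^sup>2"
          by (simp add: E_def abs_mult power2_norm_eq_inner)
        also have "\<dots> \<le> (2 * K / \<kappa> * (d v)\<^sup>2 * norm (q v)) * norm (q v) / (norm (q v))\<^sup>2"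
          using e_bound[of v] that component_le_norm_cart[of "e v" i] component_le_norm_cart[of "q v" j]
          by (intro divide_right_mono mult_mono) auto
        also have "\<dots> = 2 * K / \<kappa> * (d v)\<^sup>2" using False by (simp add: power2_eq_square)
        finally show ?thesis .
      qed (use pos in \<open>simp add: E_def\<close>)
      have "((\<lambda>v. E v i j) \<longlongrightarrow> 0) (at u)"
      proof (rule Lim_null_comparison)
        show "\<forall>\<^sub>F v in at u. norm (E v i j) \<le> 2 * K / \<kappa> * (d v)\<^sup>2"
          using nearV by eventually_elim (rule bound)
        have "((\<lambda>v. 2 * K / \<kappa> * (d v)\<^sup>2) \<longlongrightarrow> 2 * K / \<kappa> * (d u)\<^sup>2) (at u)"
          using d_cont[of u] unfolding isCont_def by (intro tendsto_intros)
        then show "((\<lambda>v. 2 * K / \<kappa> * (d v)\<^sup>2) \<longlongrightarrow> 0) (at u)" using 1 by simp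
      qed
      then show ?thesis unfolding E0 .
    next
      case 2
      then have fu: "f u = 0" using zero_iff[OF u] by (simp add: q_def)
      have "isCont (\<lambda>v. norm (f v) - \<kappa> * d v ^ r) u"
        by (intro continuous_intros f_cont[OF u] d_cont)
      moreover have "norm (f u) - \<kappa> * d u ^ r < 0" using fu 2 pos by simp
      ultimately have "\<forall>\<^sub>F v in at u. norm (f v) - \<kappa> * d v ^ r < 0"
        unfolding isCont_def by (rule order_tendstoD(2))
      then have "\<forall>\<^sub>F v in at u. E v i j = 0"
        using nearV
      proof eventually_elim
        case (elim v)
        then have "e v = 0" using horn[of v] by (simp add: e_def q_def d_def)
        then show ?case by (simp add: E_def)
      qed
      moreover have "E u i j = 0" using 2 by (simp add: E_def)
      ultimately show ?thesis by (simp add: tendsto_eventually)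
    next
      case 3
      have "isCont (\<lambda>v. e v $ i * q v $ j / (q v \<bullet> q v)) u"
        unfolding e_def using 3 by (intro continuous_intros f_cont[OF u] q_cont[OF u]) auto
      then show ?thesis by (simp add: isCont_def E_def)
    qed
  qed
  have T_cont: "continuous_on ?V T"
  proof (intro continuous_at_imp_continuous_on ballI)
    fix u assume u: "u \<in> ?V"
    show "isCont T u" unfolding isCont_def T_def by (intro tendsto_intros E_lim[OF u])
  qed
  have "\<phi> (x, t) = (fst (\<phi> (x, t)), t)" for x t using snd[of "(x, t)"] by (simp add: prod_eq_iff)
  then have 1: "\<exists>\<phi>\<^sub>1. \<forall>(x, t)\<in>?V. \<phi> (x, t) = (\<phi>\<^sub>1 (x, t), t)"
    by (intro exI[of _ "\<lambda>u. fst (\<phi> u)"]) auto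
  have 2: "homeomorphism ?V (\<phi> ` ?V) \<phi> \<psi>"
    by (rule homeomorphism_of_subsets[OF homeo]) auto
  have 3: "\<phi> (x, t) = (x, t)" if "x \<in> S" for x t
    using fixed[of "(x, t)"] that by simp
  have 4: "\<phi> ` (f -` {0} \<inter> ?V) = g -` {0} \<inter> \<phi> ` ?V"
    using zero_iff by auto
  have "BD_equivalence_map S f g ?V \<phi>"
    unfolding BD_equivalence_map_def using 1 2 3 4 pos S fixed[of 0] by auto
  then show ?thesis
    unfolding C0_BD_equivalent_def C0_contact_equivalent_def using T_cont inv conj by blast
qed

section \<open>Flatness along the cylinder over \<open>\<Sigma>\<close>\<close>

text \<open>The expansion is centred at \<open>a = (x, snd u)\<close> with \<open>x\<close> nearest
  to \<open>fst u\<close> in \<open>S\<close>, at distance exactly \<open>d u\<close> from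
  \<open>u\<close>. As \<open>norm a \<le> 2 * norm u\<close>, the radius is halved for the values,
  and once more for the gradients.\<close>

lemma flat_of_equal_jets_on_cylinder:
  fixes f g :: "(real^'n) \<times> (real^'l) \<Rightarrow> real^'p"
  assumes S: "closed S" "0 \<in> S" and W: "open W" "cball 0 R \<subseteq> W"
    and fg: "Ck_on (r + 2) f W" "Ck_on (r + 2) g W"
    and jets: "\<And>a. fst a \<in> S \<Longrightarrow> norm a \<le> R \<Longrightarrow> taylor_jet (r + 2) f a = taylor_jet (r + 2) g a"
  shows "\<exists>K\<ge>0. (\<forall>u. norm u \<le> R / 4 \<longrightarrow> norm (g u - f u) \<le> K * infdist (fst u) S ^ (r + 2)) \<and>
    (\<forall>u j. norm u \<le> R / 4 \<and> 0 < infdist (fst u) S \<longrightarrow>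
      norm (grad_x g j u - grad_x f j u) \<le> K * infdist (fst u) S ^ (r + 1))"
proof -
  define d where "d = (\<lambda>u::(real^'n) \<times> (real^'l). infdist (fst u) S)"
  define h where "h = (\<lambda>u. g u - f u)"
  have h: "Ck_on (r + 2) h W" unfolding h_def by (rule Ck_on_diff[OF W(1) fg])
  have d0: "0 \<le> d u" for u by (simp add: d_def infdist_nonneg)
  have d_le: "d u \<le> norm u" for u
  proof -
    have "d u \<le> dist (fst u) 0" unfolding d_def by (rule infdist_le[OF S(2)])
    also have "\<dots> \<le> norm u" using norm_fst_le[of "fst u" "snd u"] by simp
    finally show ?thesis .
  qed
  have d_lip: "\<bar>d u - d v\<bar> \<le> norm (u - v)" for u v
  proof -
    have "\<bar>d u - d v\<bar> \<le> dist (fst u) (fst v)" unfolding d_def by (rule infdist_triangle_abs)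
    also have "\<dots> \<le> dist u v" by (rule dist_fst_le)
    finally show ?thesis by (simp add: dist_norm)
  qed
  obtain C where C: "0 \<le> C" "\<forall>a v. norm a \<le> R \<and> norm (a + v) \<le> R \<and>
      taylor_jet (r + 2) f a = taylor_jet (r + 2) g a \<longrightarrow> norm (g (a + v) - f (a + v)) \<le> C * norm v ^ (r + 2)"
    using equal_jets_imp_flat[OF W fg] by (auto simp del: power_Suc)
  have flat: "norm (h u) \<le> C * d u ^ (r + 2)" if u: "norm u \<le> R / 2" for u
  proof -
    obtain x where x: "x \<in> S" "infdist (fst u) S = dist (fst u) x"
      using infdist_attains_inf[OF S(1), of "fst u"] S(2) by auto
    define a where "a = (x, snd u)"
    have ua: "u - a = (fst u - x, 0)" by (simp add: a_def prod_eq_iff)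
    then have n: "norm (u - a) = d u" by (simp add: d_def x dist_norm norm_Pair)
    have "norm a \<le> norm u + norm (u - a)" using norm_triangle_ineq4[of u "u - a"] by simp
    then have a: "norm a \<le> R" using n d_le[of u] u by simp
    have "norm u \<le> R" using u norm_ge_zero[of u] by linarith
    then have "norm (g (a + (u - a)) - f (a + (u - a))) \<le> C * norm (u - a) ^ (r + 2)"
      using a jets[of a] x by (intro C(2)[rule_format]) (simp add: a_def)
    then show ?thesis by (simp add: h_def n)
  qed
  have WR: "cball 0 (R / 2) \<subseteq> W"
  proof
    fix u :: "(real^'n) \<times> (real^'l)" assume "u \<in> cball 0 (R / 2)"
    then have "norm u \<le> R / 2" by simp
    then have "norm u \<le> R" using norm_ge_zero[of u] by linarith
    then show "u \<in> W" using W by auto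
  qed
  obtain A where A: "0 \<le> A" "\<forall>u v. norm u \<le> R / 2 / 2 \<and> 0 < d u \<and> d u \<le> R / 2 / 2 \<and> norm v \<le> 1 \<longrightarrow>
      norm (frechet_derivative h (at u) v) \<le> A * d u ^ (r + 2 - 1)"
    using flat_imp_derivative_flat[OF W(1) WR h _ flat C(1) d0 d_lip] by auto
  have grad: "norm (grad_x g j u - grad_x f j u) \<le> A * d u ^ (r + 1)"
    if u: "norm u \<le> R / 4" "0 < d u" for u j
  proof -
    define p where "p = grad_x g j u - grad_x f j u"
    \<comment> \<open>Testing the derivative of \<open>h\<close> in the direction of
      \<open>p\<close> itself returns \<open>norm p\<close> as its \<open>j\<close>-th
      component.\<close>
    define e where "e = (sgn p, 0 :: real^'l)"
    have uW: "u \<in> W"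
    proof -
      have "norm u \<le> R" using u norm_ge_zero[of u] by linarith
      then show ?thesis using W by auto
    qed
    have df: "f differentiable (at u)" and dg: "g differentiable (at u)" using fg uW by auto
    have "(h has_derivative (\<lambda>v. frechet_derivative g (at u) v - frechet_derivative f (at u) v)) (at u)"
      unfolding h_def using df dg by (intro has_derivative_diff) (simp_all add: frechet_derivative_works)
    then have Dh: "frechet_derivative h (at u) = (\<lambda>v. frechet_derivative g (at u) v - frechet_derivative f (at u) v)"
      by (rule frechet_derivative_at[symmetric])
    have "norm p = sgn p \<bullet> p"
      by (cases "p = 0") (simp_all add: sgn_div_norm dot_square_norm power2_eq_square)
    also have "\<dots> = frechet_derivative h (at u) e $ j"
      by (simp add: p_def inner_diff_right grad_x_inner[OF df] grad_x_inner[OF dg] Dh e_def)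
    also have "\<dots> \<le> norm (frechet_derivative h (at u) e)"
      using component_le_norm_cart[of "frechet_derivative h (at u) e" j] by linarith
    also have "\<dots> \<le> A * d u ^ (r + 2 - 1)"
      by (rule A(2)[rule_format]) (use u d_le[of u] in \<open>auto simp: e_def norm_Pair norm_sgn\<close>)
    finally show ?thesis by (simp add: p_def)
  qed
  show ?thesis
  proof (intro exI[of _ "C + A"] conjI allI impI)
    fix u :: "(real^'n) \<times> (real^'l)" assume u: "norm u \<le> R / 4"
    then have "norm u \<le> R / 2" using norm_ge_zero[of u] by linarith
    from flat[OF this] have "norm (g u - f u) \<le> C * d u ^ (r + 2)" by (simp add: h_def)
    also have "\<dots> \<le> (C + A) * d u ^ (r + 2)" using A d0 by (intro mult_right_mono) auto
    finally show "norm (g u - f u) \<le> (C + A) * infdist (fst u) S ^ (r + 2)" by (simp add: d_def)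
  next
    fix u :: "(real^'n) \<times> (real^'l)" and j
    assume u: "norm u \<le> R / 4 \<and> 0 < infdist (fst u) S"
    then have "norm (grad_x g j u - grad_x f j u) \<le> A * d u ^ (r + 1)" by (intro grad) (auto simp: d_def)
    also have "\<dots> \<le> (C + A) * d u ^ (r + 1)" using C d0 by (intro mult_right_mono) auto
    finally show "norm (grad_x g j u - grad_x f j u) \<le> (C + A) * infdist (fst u) S ^ (r + 1)"
      by (simp add: d_def)
  qed (use A C in simp)
qed

theorem corollary1p3:
  fixes \<Sigma> :: "(real^'n) set"
    and f g :: "(real^'n) \<times> (real^'l) \<Rightarrow> real^'p"
    and r :: nat and \<delta> :: real
  assumes "closed \<Sigma>" and "0 \<in> \<Sigma>"
    and "r \<ge> 1" and "\<delta> > 0"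
    and "Ck_map_germ (r + 2) f"
    and "rel_kuo_condition \<Sigma> r \<delta> f"
    and "Ck_map_germ (r + 2) g"
    and "\<exists>U. open U \<and> 0 \<in> U \<and>
           (\<forall>a \<in> (\<Sigma> \<times> UNIV) \<inter> U. taylor_jet (r + 2) f a = taylor_jet (r + 2) g a)"
  shows "C0_BD_equivalent \<Sigma> f g \<and> C0_contact_equivalent \<Sigma> f g"
proof -
  obtain Wf Wg U where Wf: "open Wf" "0 \<in> Wf" "Ck_on (r + 2) f Wf"
    and Wg: "open Wg" "0 \<in> Wg" "Ck_on (r + 2) g Wg"
    and U: "open U" "0 \<in> U" "\<forall>a \<in> (\<Sigma> \<times> UNIV) \<inter> U. taylor_jet (r + 2) f a = taylor_jet (r + 2) g a"
    using assms unfolding Ck_map_germ_def by metis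
  define W where "W = Wf \<inter> Wg \<inter> U"
  have W: "open W" "0 \<in> W" using Wf Wg U by (auto simp: W_def)
  have fg: "Ck_on (r + 2) f W" "Ck_on (r + 2) g W"
    by (rule Ck_on_subset[OF Wf(3)], simp add: W_def le_infI1)
      (rule Ck_on_subset[OF Wg(3)], simp add: W_def le_infI1)
  obtain R where R: "0 < R" "cball 0 R \<subseteq> W" using W open_contains_cball by blast
  have jets: "taylor_jet (r + 2) f a = taylor_jet (r + 2) g a" if "fst a \<in> \<Sigma>" "norm a \<le> R" for a
    using U(3) R(2) that by (auto simp: W_def mem_Times_iff)
  obtain K where K: "0 \<le> K"
    "\<forall>u. norm u \<le> R / 4 \<longrightarrow> norm (g u - f u) \<le> K * infdist (fst u) \<Sigma> ^ (r + 2)"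
    "\<forall>u j. norm u \<le> R / 4 \<and> 0 < infdist (fst u) \<Sigma> \<longrightarrow>
      norm (grad_x g j u - grad_x f j u) \<le> K * infdist (fst u) \<Sigma> ^ (r + 1)"
    using flat_of_equal_jets_on_cylinder[OF assms(1,2) W(1) R(2) fg jets] by blast
  obtain c a w where c: "0 < c" and a: "0 < a" and w: "0 < w" and
    kuo: "\<forall>u. u \<in> horn_nbhd \<Sigma> r f w \<and> norm u < a \<longrightarrow> c * infdist (fst u) \<Sigma> powr (real r - \<delta>) \<le> kuo_dist f u"
    using assms(6) unfolding rel_kuo_condition_def by blast
  let ?p = "real CARD('p)"
  \<comment> \<open>Each of the first three summands yields one smallness condition once
    \<open>M * \<alpha> \<le> 1\<close>; the last one gives \<open>\<alpha> \<le> 1\<close>.\<close>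
  define M where "M = 2 ^ (r + 2) * 2 ^ (r + 3) * K / w + 2 * ?p\<^sup>2 * K / c + 16 * ?p * K / c + 1"
  have M: "1 \<le> M" "2 ^ (r + 2) * 2 ^ (r + 3) * K / w \<le> M" "2 * ?p\<^sup>2 * K / c \<le> M" "16 * ?p * K / c \<le> M"
    using c w K(1) by (auto simp: M_def)
  define \<alpha> where "\<alpha> = min (min (R / 4) (a / 2)) (1 / M)"
  have \<alpha>: "0 < \<alpha>" "\<alpha> \<le> R / 4" "\<alpha> < a" "M * \<alpha> \<le> 1" "\<alpha> \<le> 1"
  proof -
    show "0 < \<alpha>" "\<alpha> \<le> R / 4" using R a M(1) by (auto simp: \<alpha>_def)
    show "\<alpha> < a" using a by (auto simp: \<alpha>_def min_less_iff_disj)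
    have "\<alpha> \<le> 1 / M" by (simp add: \<alpha>_def)
    then show M\<alpha>: "M * \<alpha> \<le> 1" using M(1) by (simp add: field_simps)
    have "1 * \<alpha> \<le> M * \<alpha>" using M(1) \<open>0 < \<alpha>\<close> by (intro mult_right_mono) auto
    then show "\<alpha> \<le> 1" using M\<alpha> by simp
  qed
  have X: "X * \<alpha> \<le> 1" if "X \<le> M" for X
    by (rule order_trans[OF mult_right_mono[OF that]]) (use \<alpha> in auto)
  have small: "2 ^ (r + 2) * K * \<alpha>\<^sup>2 \<le> w / 2 ^ (r + 3)"
  proof -
    have "2 ^ (r + 2) * 2 ^ (r + 3) * K * \<alpha> \<le> w" using X[OF M(2)] w by (simp add: field_simps)
    then have "2 ^ (r + 2) * K * \<alpha> \<le> w / 2 ^ (r + 3)" by (simp add: pos_le_divide_eq mult_ac)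
    moreover have "2 ^ (r + 2) * K * \<alpha>\<^sup>2 \<le> 2 ^ (r + 2) * K * \<alpha>"
      using \<alpha> K(1) by (intro mult_left_mono) (auto simp: power2_eq_square mult_left_le)
    ultimately show ?thesis by linarith
  qed
  have cb: "cball 0 \<alpha> \<subseteq> W"
  proof -
    have "cball (0 :: (real^'n) \<times> (real^'l)) \<alpha> \<subseteq> cball 0 R"
      using \<alpha> R by (intro subset_cball) auto
    then show ?thesis using R by blast
  qed
  interpret flat_deformation \<Sigma> f g r W \<alpha> K w c
  proof
    show "Ck_on 2 f W" "Ck_on 2 g W" by (rule Ck_on_le[OF fg(1)], simp) (rule Ck_on_le[OF fg(2)], simp)
    show "norm (g u - f u) \<le> K * infdist (fst u) \<Sigma> ^ (r + 2)" if "norm u \<le> \<alpha>" for u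
      by (rule K(2)[rule_format]) (use that \<alpha> in linarith)
    show "norm (grad_x g j u - grad_x f j u) \<le> K * infdist (fst u) \<Sigma> ^ (r + 1)"
      if "norm u \<le> \<alpha>" "0 < infdist (fst u) \<Sigma>" for u j
      by (rule K(3)[rule_format]) (use that \<alpha> in linarith)
    show "c * infdist (fst u) \<Sigma> ^ r \<le> kuo_dist f u"
      if u: "norm u \<le> \<alpha>" "0 < infdist (fst u) \<Sigma>" "norm (f u) \<le> w * infdist (fst u) \<Sigma> ^ r" for u
    proof -
      have "infdist (fst u) \<Sigma> \<le> dist (fst u) 0" by (rule infdist_le[OF assms(2)])
      also have "\<dots> \<le> norm u" using norm_fst_le[of "fst u" "snd u"] by simp
      finally have "infdist (fst u) \<Sigma> \<le> 1" using u \<alpha> by linarith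
      \<comment> \<open>Here \<open>\<delta> > 0\<close> enters: for a base in
        \<open>(0, 1]\<close>, lowering the exponent raises the power.\<close>
      then have "infdist (fst u) \<Sigma> powr real r \<le> infdist (fst u) \<Sigma> powr (real r - \<delta>)"
        using assms(4) u by (intro powr_mono') auto
      then have "c * infdist (fst u) \<Sigma> ^ r \<le> c * infdist (fst u) \<Sigma> powr (real r - \<delta>)"
        using c u by (intro mult_left_mono) (auto simp: powr_realpow)
      also have "\<dots> \<le> kuo_dist f u" by (rule kuo[rule_format]) (use u \<alpha> in \<open>simp add: horn_nbhd_def\<close>)
      finally show ?thesis .
    qed
    show "2 * ?p\<^sup>2 * K * \<alpha> \<le> c" "16 * ?p * K * \<alpha> \<le> c"
      using X[OF M(3)] X[OF M(4)] c by (simp_all add: field_simps)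
  qed (fact assms W cb \<alpha> K w c small)+
  obtain \<phi> \<psi> where \<phi>: "homeomorphism UNIV UNIV \<phi> \<psi>" "\<forall>u. snd (\<phi> u) = snd u"
    "\<forall>u. norm (\<phi> u - u) \<le> infdist (fst u) \<Sigma> / 3"
    "\<forall>u. norm u < \<alpha> / 4 \<longrightarrow> norm (g (\<phi> u) - f u) \<le> 2 ^ (r + 2) * K * infdist (fst u) \<Sigma> ^ (r + 2)"
    "\<forall>u. norm u < \<alpha> / 4 \<and> norm (f u) \<le> w / 2 ^ (r + 3) * infdist (fst u) \<Sigma> ^ r \<longrightarrow> g (\<phi> u) = f u"
    using deformation_trivialised by blast
  have cont: "continuous_on W f" "continuous_on W g"
    using Ck_on_le[OF fg(1), of 0] Ck_on_le[OF fg(2), of 0] by auto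
  have \<phi>W: "\<phi> u \<in> W" if "norm u < \<alpha> / 4" for u
  proof -
    have "norm (\<phi> u) \<le> norm u + norm (\<phi> u - u)" using norm_triangle_ineq[of u "\<phi> u - u"] by simp
    then have "norm (\<phi> u) \<le> \<alpha>"
      using \<phi>(3)[rule_format, of u] d_le_norm[of u] that \<alpha>(1) unfolding d_def by linarith
    then show ?thesis using cb by auto
  qed
  show ?thesis
  \<comment> \<open>The roles of \<open>K\<close> and \<open>\<kappa>\<close> are taken by
    \<open>2 ^ (r + 2) * K\<close> and \<open>w / 2 ^ (r + 3)\<close>, for which the required
    smallness follows from the first condition on \<open>\<alpha>\<close>.\<close>
  proof (rule equivalences_of_approximate_conjugation[where \<beta> = "\<alpha> / 4" and r = r])
    show "homeomorphism UNIV UNIV \<phi> \<psi>" by (rule \<phi>)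
    show "\<phi> u = u" if "infdist (fst u) \<Sigma> = 0" for u using \<phi>(3)[rule_format, of u] that by simp
    show "continuous_on (ball 0 (\<alpha> / 4)) f"
    proof (rule continuous_on_subset[OF cont(1)])
      have "ball 0 (\<alpha> / 4) \<subseteq> cball (0 :: (real^'n) \<times> (real^'l)) \<alpha>" using \<alpha>(1) by auto
      then show "ball 0 (\<alpha> / 4) \<subseteq> W" using cb by blast
    qed
    show "continuous_on (ball 0 (\<alpha> / 4)) (\<lambda>u. g (\<phi> u))"
      by (rule continuous_on_compose2[OF cont(2)
            continuous_on_subset[OF homeomorphism_cont1[OF \<phi>(1)]]]) (use \<phi>W in auto)
    have "4 * (2 ^ (r + 2) * K) * (\<alpha> / 4)\<^sup>2 = (2 ^ (r + 2) * K * \<alpha>\<^sup>2) / 4" by (simp add: power_divide)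
    also have "\<dots> \<le> w / 2 ^ (r + 3)"
    proof -
      have "0 \<le> 2 ^ (r + 2) * K * \<alpha>\<^sup>2" using K(1) by simp
      then show ?thesis using small by linarith
    qed
    finally show "4 * (2 ^ (r + 2) * K) * (\<alpha> / 4)\<^sup>2 \<le> w / 2 ^ (r + 3)" .
  qed (use assms(2) \<alpha>(1) K(1) w \<phi> in auto)
qed

end
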